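(* Let $G$ be a finite group of even order which contains a broad subgroup. Then there is an involution $t \in G$ such that the number of complex irreducible characters of $G$ which lie in $2$-blocks of positive defect of $G$ is at most $|C_{G}(t)|$.
   Context: An involution is an element of order $2$. An elementary abelian $2$-subgroup $E$ of a finite group $G$ is called a broad subgroup of $G$ if every involution of $G$ is $G$-conjugate to an element of $E$. A $2$-block has positive defect if its defect groups are non-trivial. *)

theory Defs
  imports
    "HOL-Algebra.Algebra"
    "Jordan_Normal_Form.Char_Poly"
    "Jordan_Normal_Form.VS_Connect"
begin

section \<open>Groups\<close>

definition involution :: "('a, 'b) monoid_scheme \<Rightarrow> 'a \<Rightarrow> bool" where
  "involution G t \<longleftrightarrow> t \<in> carrier G \<and> group.ord G t = 2"

definition conj_class :: "('a, 'b) monoid_scheme \<Rightarrow> 'a \<Rightarrow> 'a set" where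
  "conj_class G x = {g \<otimes>\<^bsub>G\<^esub> x \<otimes>\<^bsub>G\<^esub> inv\<^bsub>G\<^esub> g | g. g \<in> carrier G}"

definition centralizer :: "('a, 'b) monoid_scheme \<Rightarrow> 'a \<Rightarrow> 'a set" where
  "centralizer G x = {g \<in> carrier G. g \<otimes>\<^bsub>G\<^esub> x = x \<otimes>\<^bsub>G\<^esub> g}"

definition elementary_abelian :: "nat \<Rightarrow> 'a set \<Rightarrow> ('a, 'b) monoid_scheme \<Rightarrow> bool" where
  "elementary_abelian p E G \<longleftrightarrow>
     subgroup E G \<and> comm_group (G\<lparr>carrier := E\<rparr>) \<and> (\<forall>x\<in>E. x [^]\<^bsub>G\<^esub> p = \<one>\<^bsub>G\<^esub>)"

definition broad_subgroup :: "'a set \<Rightarrow> ('a, 'b) monoid_scheme \<Rightarrow> bool" where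
  "broad_subgroup E G \<longleftrightarrow>
     elementary_abelian 2 E G \<and> (\<forall>t. involution G t \<longrightarrow> conj_class G t \<inter> E \<noteq> {})"

definition sylow_subgroup :: "nat \<Rightarrow> 'a set \<Rightarrow> ('a, 'b) monoid_scheme \<Rightarrow> 'a set \<Rightarrow> bool" where
  "sylow_subgroup p H G P \<longleftrightarrow>
     subgroup P G \<and> P \<subseteq> H \<and> card P = p ^ multiplicity p (card H)"


section \<open>Complex irreducible characters\<close>

definition GL :: "nat \<Rightarrow> complex mat monoid" where
  "GL n = units_of (ring_mat TYPE(complex) n ())"

definition irreducible_rep :: "('a, 'b) monoid_scheme \<Rightarrow> nat \<Rightarrow> ('a \<Rightarrow> complex mat) \<Rightarrow> bool" where
  "irreducible_rep G n \<rho> \<longleftrightarrow>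
     0 < n \<and> \<rho> \<in> hom G (GL n) \<and>
     (\<forall>W. subspace class_ring W (module_vec TYPE(complex) n) \<and>
          (\<forall>g\<in>carrier G. \<forall>w\<in>W. \<rho> g *\<^sub>v w \<in> W)
        \<longrightarrow> W = {0\<^sub>v n} \<or> W = carrier_vec n)"

definition mat_trace :: "complex mat \<Rightarrow> complex" where
  "mat_trace A = (\<Sum>i<dim_row A. A $$ (i, i))"

text \<open>Restricting to \<open>carrier G\<close> makes each character a single element of the function type,
  so that cardinalities of sets of characters are the intended ones.\<close>

definition Irr :: "('a, 'b) monoid_scheme \<Rightarrow> ('a \<Rightarrow> complex) set" where
  "Irr G = {\<chi>. \<exists>n \<rho>. irreducible_rep G n \<rho> \<and> \<chi> = (\<lambda>g\<in>carrier G. mat_trace (\<rho> g))}"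

text \<open>The value \<open>\<omega>\<^sub>\<chi>(K)\<close> of the central character of \<open>\<chi>\<close> at the sum of the class \<open>K\<close> of \<open>x\<close>.\<close>

definition central_char :: "('a, 'b) monoid_scheme \<Rightarrow> ('a \<Rightarrow> complex) \<Rightarrow> 'a \<Rightarrow> complex" where
  "central_char G \<chi> x = of_nat (card (conj_class G x)) * \<chi> x / \<chi> \<one>\<^bsub>G\<^esub>"


section \<open>Reduction modulo a maximal ideal of the ring of algebraic integers\<close>

definition alg_ints :: "complex ring" where
  "alg_ints = \<lparr>carrier = {z. algebraic_int z}, monoid.mult = (*), one = 1, ring.zero = 0, add = (+)\<rparr>"

definition maxideal_over :: "nat \<Rightarrow> complex set \<Rightarrow> bool" where
  "maxideal_over p M \<longleftrightarrow> maximalideal M alg_ints \<and> of_nat p \<in> M"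

text \<open>The localization \<open>S\<close> of the ring of algebraic integers at \<open>M\<close>, its maximal ideal,
  and the reduction map from \<open>S\<close> onto the residue field, which has characteristic \<open>p\<close> if
  \<open>maxideal_over p M\<close>.\<close>

definition loc_ring :: "complex set \<Rightarrow> complex ring" where
  "loc_ring M = \<lparr>carrier = {r / s | r s. r \<in> carrier alg_ints \<and> s \<in> carrier alg_ints - M},
     monoid.mult = (*), one = 1, ring.zero = 0, add = (+)\<rparr>"

definition loc_ideal :: "complex set \<Rightarrow> complex set" where
  "loc_ideal M = {r / s | r s. r \<in> M \<and> s \<in> carrier alg_ints - M}"

definition residue_field :: "complex set \<Rightarrow> complex set ring" where
  "residue_field M = loc_ring M Quot loc_ideal M"

definition red :: "complex set \<Rightarrow> complex \<Rightarrow> complex set" where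
  "red M z = loc_ideal M +>\<^bsub>loc_ring M\<^esub> z"


section \<open>Blocks and defect groups\<close>

text \<open>A block is represented by the set of its complex irreducible characters.  These sets are the
  classes of the relation: same central character after reduction.\<close>

definition block_rel ::
    "('a, 'b) monoid_scheme \<Rightarrow> complex set \<Rightarrow> (('a \<Rightarrow> complex) \<times> ('a \<Rightarrow> complex)) set" where
  "block_rel G M = {(\<chi>, \<psi>). \<chi> \<in> Irr G \<and> \<psi> \<in> Irr G \<and>
     (\<forall>x\<in>carrier G. red M (central_char G \<chi> x) = red M (central_char G \<psi> x))}"

definition blocks :: "('a, 'b) monoid_scheme \<Rightarrow> complex set \<Rightarrow> ('a \<Rightarrow> complex) set set" where
  "blocks G M = Irr G // block_rel G M"

text \<open>The coefficient at \<open>x\<close> of the sum of the central idempotents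
  \<open>e\<^sub>\<chi> = \<chi>(1)/|G| \<Sum>\<^sub>g \<chi>(g\<inverse>) g\<close> over \<open>\<chi>\<close> in \<open>B\<close>.  For a block \<open>B\<close> it lies in the localization
  (a theorem of Osima), and its reduction is the coefficient at \<open>x\<close> of the block idempotent.\<close>

definition idem_coeff :: "('a, 'b) monoid_scheme \<Rightarrow> ('a \<Rightarrow> complex) set \<Rightarrow> 'a \<Rightarrow> complex" where
  "idem_coeff G B x = (\<Sum>\<chi>\<in>B. \<chi> \<one>\<^bsub>G\<^esub> * \<chi> (inv\<^bsub>G\<^esub> x) / of_nat (Coset.order G))"

text \<open>The class of \<open>x\<close> is a defect class of \<open>B\<close> if neither the reduced central character nor the
  block idempotent of \<open>B\<close> vanishes there; a defect group of \<open>B\<close> is a Sylow \<open>p\<close>-subgroup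
  of the centralizer of an element of a defect class.\<close>

definition in_defect_class ::
    "('a, 'b) monoid_scheme \<Rightarrow> complex set \<Rightarrow> ('a \<Rightarrow> complex) set \<Rightarrow> 'a \<Rightarrow> bool" where
  "in_defect_class G M B x \<longleftrightarrow> x \<in> carrier G \<and>
     (\<forall>\<chi>\<in>B. red M (central_char G \<chi> x) \<noteq> \<zero>\<^bsub>residue_field M\<^esub>) \<and>
     red M (idem_coeff G B x) \<noteq> \<zero>\<^bsub>residue_field M\<^esub>"

definition defect_group ::
    "nat \<Rightarrow> ('a, 'b) monoid_scheme \<Rightarrow> complex set \<Rightarrow> ('a \<Rightarrow> complex) set \<Rightarrow> 'a set \<Rightarrow> bool" where
  "defect_group p G M B D \<longleftrightarrow>
     (\<exists>x. in_defect_class G M B x \<and> sylow_subgroup p (centralizer G x) G D)"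

definition positive_defect ::
    "nat \<Rightarrow> ('a, 'b) monoid_scheme \<Rightarrow> complex set \<Rightarrow> ('a \<Rightarrow> complex) set \<Rightarrow> bool" where
  "positive_defect p G M B \<longleftrightarrow> (\<forall>D. defect_group p G M B D \<longrightarrow> D \<noteq> {\<one>\<^bsub>G\<^esub>})"


section \<open>Existence of the maximal ideal\<close>

lemma algebraic_int_eigen:
  fixes z :: complex and w :: "nat \<Rightarrow> complex"
  assumes "k < N" "w k \<noteq> 0"
    and "\<And>i. i < N \<Longrightarrow> \<exists>a::nat \<Rightarrow> int. z * w i = (\<Sum>l<N. of_int (a l) * w l)"
  shows "algebraic_int z"
proof -
  obtain a :: "nat \<Rightarrow> nat \<Rightarrow> int"
    where a: "\<And>i. i < N \<Longrightarrow> z * w i = (\<Sum>l<N. of_int (a i l) * w l)"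
    using assms(3) by metis
  define A where "A = mat N N (\<lambda>(i, l). a i l)"
  define B :: "complex mat" where "B = map_mat of_int A"
  define v where "v = vec N w"
  have cA: "A \<in> carrier_mat N N" and cB: "B \<in> carrier_mat N N"
    by (auto simp: A_def B_def)
  have "B *\<^sub>v v = z \<cdot>\<^sub>v v"
    by (rule eq_vecI)
      (auto simp: A_def B_def v_def scalar_prod_def a lessThan_atLeast0 intro!: sum.cong)
  moreover have "v \<noteq> 0\<^sub>v N"
  proof
    assume "v = 0\<^sub>v N"
    then have "v $ k = 0" using assms(1) by simp
    then show False using assms by (simp add: v_def)
  qed
  ultimately have "eigenvalue B z"
    using cB unfolding eigenvalue_def eigenvector_def
    by (intro exI[of _ v]) (simp add: carrier_matD(1)[OF cB], simp add: v_def)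
  then have "poly (char_poly B) z = 0"
    using eigenvalue_root_char_poly[OF cB] by simp
  then have "poly (map_poly of_int (char_poly A)) z = 0"
    using of_int_hom.char_poly_hom[OF cA, where 'a = complex] by (simp add: B_def)
  moreover have "lead_coeff (char_poly A) = 1"
    using degree_monic_char_poly[OF cA] by simp
  ultimately show ?thesis
    unfolding algebraic_int_altdef_ipoly by blast
qed

lemma algebraic_int_power_reduce:
  fixes x :: complex
  assumes "algebraic_int x"
  obtains m c where "0 < m" "x ^ m = (\<Sum>i<m. of_int (c i :: int) * x ^ i)"
proof -
  from assms obtain p :: "int poly"
    where p: "poly (map_poly of_int p) x = 0" "lead_coeff p = 1"
    unfolding algebraic_int_altdef_ipoly by blast
  have d: "degree (map_poly of_int p :: complex poly) = degree p" by simp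
  have "0 = (\<Sum>i\<le>degree p. of_int (coeff p i) * x ^ i)"
    using p(1) unfolding poly_altdef d by simp
  also have "\<dots> = (\<Sum>i<degree p. of_int (coeff p i) * x ^ i) + x ^ degree p"
    using p(2) by (simp add: lessThan_Suc_atMost[symmetric])
  finally have eq: "x ^ degree p = (\<Sum>i<degree p. of_int (- coeff p i) * x ^ i)"
    by (simp add: sum_negf eq_neg_iff_add_eq_0 add.commute)
  have "0 < degree p"
    using eq by (cases "degree p") auto
  then show ?thesis using eq that[of "degree p" "\<lambda>i. - coeff p i"] by blast
qed

lemma algebraic_int_add_mult:
  fixes x y :: complex
  assumes "algebraic_int x" "algebraic_int y"
  shows "algebraic_int (x + y) \<and> algebraic_int (x * y)"
proof -
  obtain m c where m: "0 < m" and xm: "x ^ m = (\<Sum>i<m. of_int (c i :: int) * x ^ i)"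
    using assms(1) by (rule algebraic_int_power_reduce)
  obtain n d where n: "0 < n" and yn: "y ^ n = (\<Sum>j<n. of_int (d j :: int) * y ^ j)"
    using assms(2) by (rule algebraic_int_power_reduce)
  define w where "w k = x ^ (k div n) * y ^ (k mod n)" for k
  define T where "T = {\<Sum>l<m * n. of_int (a l) * w l | a :: nat \<Rightarrow> int. True}"
  have T_0: "0 \<in> T"
    unfolding T_def by (auto intro!: exI[of _ "\<lambda>_. 0"])
  have T_add: "s + t \<in> T" if st: "s \<in> T" "t \<in> T" for s t
  proof -
    obtain a :: "nat \<Rightarrow> int" where "s = (\<Sum>l<m * n. of_int (a l) * w l)"
      using st(1) unfolding T_def by blast
    moreover obtain b :: "nat \<Rightarrow> int" where "t = (\<Sum>l<m * n. of_int (b l) * w l)"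
      using st(2) unfolding T_def by blast
    ultimately have "s + t = (\<Sum>l<m * n. of_int (a l + b l) * w l)"
      by (simp add: sum.distrib ring_distribs)
    then show ?thesis unfolding T_def by (auto intro!: exI[of _ "\<lambda>l. a l + b l"])
  qed
  have T_scale: "of_int b * t \<in> T" if t: "t \<in> T" for b t
  proof -
    obtain a :: "nat \<Rightarrow> int" where "t = (\<Sum>l<m * n. of_int (a l) * w l)"
      using t unfolding T_def by blast
    then have "of_int b * t = (\<Sum>l<m * n. of_int (b * a l) * w l)"
      by (simp add: sum_distrib_left mult.assoc)
    then show ?thesis unfolding T_def by (auto intro!: exI[of _ "\<lambda>l. b * a l"])
  qed
  have T_sum: "(\<Sum>i<k. of_int (a i) * f i) \<in> T" if "\<And>i. i < k \<Longrightarrow> f i \<in> T"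
    for k and a :: "nat \<Rightarrow> int" and f
    using that by (induction k) (auto intro: T_0 T_add T_scale)
  have T_mon: "x ^ i * y ^ j \<in> T" if "i < m" "j < n" for i j
  proof -
    have "i * n + j < i * n + n" using that by simp
    also have "i * n + n \<le> m * n"
      using mult_le_mono1[of "Suc i" m n] that(1) by simp
    finally have lt: "i * n + j < m * n" .
    have "x ^ i * y ^ j = w (i * n + j)"
      using that n by (simp add: w_def)
    also have "\<dots> = (\<Sum>l<m * n. of_int (if l = i * n + j then 1 else 0) * w l)"
      using lt by (simp add: if_distrib[of of_int] if_distrib[of "\<lambda>t. t * _"] cong: if_cong)
    finally show ?thesis
      unfolding T_def by (auto intro!: exI[of _ "\<lambda>l. if l = i * n + j then 1 else 0"])
  qed
  have x_T: "x * (x ^ i * y ^ j) \<in> T" if "i < m" "j < n" for i j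
  proof (cases "Suc i < m")
    case True
    then show ?thesis using T_mon[OF True that(2)] by (simp add: mult.assoc)
  next
    case False
    then have "m = Suc i" using that by simp
    then have "x * (x ^ i * y ^ j) = x ^ m * y ^ j" by (simp add: mult.assoc)
    also have "\<dots> = (\<Sum>i<m. of_int (c i) * (x ^ i * y ^ j))"
      unfolding xm by (simp add: sum_distrib_right mult.assoc)
    finally show ?thesis using T_sum T_mon that by simp
  qed
  have y_T: "y * (x ^ i * y ^ j) \<in> T" if "i < m" "j < n" for i j
  proof (cases "Suc j < n")
    case True
    then show ?thesis using T_mon[OF that(1) True] by (simp add: algebra_simps)
  next
    case False
    then have "n = Suc j" using that by simp
    then have "y * (x ^ i * y ^ j) = x ^ i * y ^ n" by (simp add: algebra_simps)
    also have "\<dots> = (\<Sum>j<n. of_int (d j) * (x ^ i * y ^ j))"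
      unfolding yn by (simp add: sum_distrib_left algebra_simps)
    finally show ?thesis using T_sum T_mon that by simp
  qed
  have ij: "k div n < m" "k mod n < n" if "k < m * n" for k
    using that n by (auto simp: less_mult_imp_div_less)
  have xw: "x * w k \<in> T" and yw: "y * w k \<in> T" if "k < m * n" for k
    using x_T y_T ij[OF that] unfolding w_def by blast+
  have x_closed: "x * t \<in> T" if t: "t \<in> T" for t
  proof -
    obtain a :: "nat \<Rightarrow> int" where "t = (\<Sum>l<m * n. of_int (a l) * w l)"
      using t unfolding T_def by blast
    then have "x * t = (\<Sum>l<m * n. of_int (a l) * (x * w l))"
      by (simp add: sum_distrib_left algebra_simps)
    then show ?thesis using T_sum xw by simp
  qed
  have alg: "algebraic_int z" if "\<And>k. k < m * n \<Longrightarrow> z * w k \<in> T" for z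
  proof (rule algebraic_int_eigen[of 0 "m * n" w])
    show "0 < m * n" "w 0 \<noteq> 0" using m n by (simp_all add: w_def)
    show "\<exists>a::nat \<Rightarrow> int. z * w i = (\<Sum>l<m * n. of_int (a l) * w l)" if "i < m * n" for i
      using \<open>\<And>k. k < m * n \<Longrightarrow> z * w k \<in> T\<close>[OF that] unfolding T_def by blast
  qed
  have "(x + y) * w k \<in> T" "(x * y) * w k \<in> T" if "k < m * n" for k
    using T_add[OF xw yw] x_closed[OF yw] that by (simp_all add: ring_distribs mult.assoc)
  then show ?thesis using alg by blast
qed

lemma cring_alg_ints: "cring alg_ints"
proof -
  have neg: "\<exists>y. algebraic_int y \<and> y + x = 0" if "algebraic_int x" for x :: complex
    using that by (intro exI[of _ "- x"]) auto
  show ?thesis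
    by (intro cringI abelian_groupI comm_monoidI)
      (auto simp: alg_ints_def algebraic_int_add_mult algebra_simps neg)
qed

lemma ideal_alg_ints_iff:
  "ideal I alg_ints \<longleftrightarrow> I \<subseteq> carrier alg_ints \<and> 0 \<in> I \<and> (\<forall>a\<in>I. \<forall>b\<in>I. a + b \<in> I) \<and>
     (\<forall>a\<in>I. \<forall>r. algebraic_int r \<longrightarrow> r * a \<in> I)" (is "_ \<longleftrightarrow> ?R")
proof
  assume "ideal I alg_ints"
  then interpret ideal I alg_ints .
  show ?R
    using Icarr additive_subgroup.zero_closed[OF is_additive_subgroup]
      additive_subgroup.a_closed[OF is_additive_subgroup] I_l_closed by (auto simp: alg_ints_def)
next
  interpret cring alg_ints by (rule cring_alg_ints)
  assume R: ?R
  have minus: "\<ominus>\<^bsub>alg_ints\<^esub> a = - a" if "algebraic_int a" for a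
    by (rule minus_equality) (use that in \<open>auto simp: alg_ints_def\<close>)
  have "- 1 * a \<in> I" if "a \<in> I" for a
    using R that algebraic_int_minus[OF algebraic_int_1] by blast
  then have neg: "- a \<in> I" if "a \<in> I" for a
    using that by force
  have sub: "algebraic_int a" if "a \<in> I" for a
    using R that by (auto simp: alg_ints_def)
  have "subgroup I (add_monoid alg_ints)"
  proof (rule add.subgroupI)
    show "I \<subseteq> carrier alg_ints" "I \<noteq> {}" using R by blast+
    show "\<ominus>\<^bsub>alg_ints\<^esub> a \<in> I" if "a \<in> I" for a
      using that by (simp add: minus sub neg)
    show "a \<oplus>\<^bsub>alg_ints\<^esub> b \<in> I" if "a \<in> I" "b \<in> I" for a b
      using R that by (simp add: alg_ints_def)
  qed
  then show "ideal I alg_ints"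
    using R by (intro idealI ring_axioms) (auto simp: alg_ints_def mult.commute)
qed

lemma maxideal_over_exists:
  assumes "1 < p"
  shows "\<exists>M. maxideal_over p M"
proof -
  let ?A = "{I. ideal I alg_ints \<and> of_nat p \<in> I \<and> 1 \<notin> I}"
  let ?P = "{r * of_nat p | r::complex. algebraic_int r}"
  have "1 \<notin> ?P"
  proof
    assume "1 \<in> ?P"
    then obtain r :: complex where r: "1 = r * of_nat p" "algebraic_int r" by blast
    then have "r = of_rat (1 / of_nat p)"
      using assms by (simp add: of_rat_divide field_simps)
    then have "r \<in> \<int>" using rational_algebraic_int_is_int[OF r(2)] by (simp add: Rats_def)
    then obtain k where "r = of_int k" by (auto elim: Ints_cases)
    then have "(of_int (k * int p) :: complex) = of_int 1" using r by simp
    then have "k * int p = 1" by (simp only: of_int_eq_iff)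
    then show False using assms zmult_eq_1_iff[of k "int p"] by auto
  qed
  moreover have "ideal ?P alg_ints"
    unfolding ideal_alg_ints_iff
  proof (intro conjI ballI allI impI)
    show "?P \<subseteq> carrier alg_ints"
      by (auto simp: alg_ints_def algebraic_int_add_mult)
    show "0 \<in> ?P" by (auto intro!: exI[of _ 0])
    show "a + b \<in> ?P" if ab: "a \<in> ?P" "b \<in> ?P" for a b
    proof -
      obtain r where "a = r * of_nat p" "algebraic_int r" using ab(1) by blast
      moreover obtain s where "b = s * of_nat p" "algebraic_int s" using ab(2) by blast
      ultimately show ?thesis
        using algebraic_int_add_mult[of r s]
        by (intro CollectI exI[of _ "r + s"]) (simp add: ring_distribs)
    qed
    show "t * a \<in> ?P" if a: "a \<in> ?P" "algebraic_int t" for a t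
    proof -
      obtain r where "a = r * of_nat p" "algebraic_int r" using a(1) by blast
      then show ?thesis
        using algebraic_int_add_mult[of t r] a(2)
        by (intro CollectI exI[of _ "t * r"]) simp
    qed
  qed
  moreover have "of_nat p \<in> ?P" by (auto intro!: exI[of _ 1])
  ultimately have P: "?P \<in> ?A" by blast
  have "\<exists>M\<in>?A. \<forall>J\<in>?A. M \<subseteq> J \<longrightarrow> J = M"
  proof (rule subset_Zorn_nonempty)
    show "?A \<noteq> {}" using P by blast
    fix C assume ne: "C \<noteq> {}" and C: "subset.chain ?A C"
    have sub: "C \<subseteq> ?A" and tot: "\<And>I J. I \<in> C \<Longrightarrow> J \<in> C \<Longrightarrow> I \<subseteq> J \<or> J \<subseteq> I"
      using C by (auto simp: subset.chain_def)
    have id: "I \<subseteq> carrier alg_ints" "0 \<in> I" "a \<in> I \<Longrightarrow> b \<in> I \<Longrightarrow> a + b \<in> I"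
        "a \<in> I \<Longrightarrow> algebraic_int r \<Longrightarrow> r * a \<in> I" if "I \<in> C" for I a b r
      using that sub ideal_alg_ints_iff[of I] by auto
    have "a + b \<in> \<Union> C" if ab: "a \<in> \<Union> C" "b \<in> \<Union> C" for a b
    proof -
      obtain I J where "I \<in> C" "J \<in> C" "a \<in> I" "b \<in> J" using ab by blast
      then show ?thesis using tot[of I J] id(3) by blast
    qed
    moreover have "\<Union> C \<subseteq> carrier alg_ints" using id(1) by blast
    moreover have "0 \<in> \<Union> C" using ne id(2) by blast
    moreover have "r * a \<in> \<Union> C" if ra: "a \<in> \<Union> C" "algebraic_int r" for a r
    proof -
      obtain I where "I \<in> C" "a \<in> I" using ra(1) by blast
      then show ?thesis using id(4) ra(2) by blast
    qed
    ultimately have "ideal (\<Union> C) alg_ints"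
      unfolding ideal_alg_ints_iff by metis
    then show "\<Union> C \<in> ?A" using ne sub by auto
  qed
  then obtain M where M: "M \<in> ?A" and max: "\<And>J. J \<in> ?A \<Longrightarrow> M \<subseteq> J \<Longrightarrow> J = M" by blast
  have "maximalideal M alg_ints"
  proof (rule maximalidealI)
    show "ideal M alg_ints" using M by blast
    show "carrier alg_ints \<noteq> M" using M by (auto simp: alg_ints_def)
    fix J assume J: "ideal J alg_ints" "M \<subseteq> J"
    show "J = M \<or> J = carrier alg_ints"
    proof (cases "1 \<in> J")
      case True
      then show ?thesis using ideal.one_imp_carrier[OF J(1)] by (simp add: alg_ints_def)
    next
      case False
      then show ?thesis using max[of J] J M by blast
    qed
  qed
  then show ?thesis using M unfolding maxideal_over_def by blast
qed

end

theory Submission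
  imports Defs "Jordan_Normal_Form.Schur_Decomposition" "Jordan_Normal_Form.Spectral_Radius"
begin

text \<open>
  Two facts carry the proof.

  Let \<open>E\<close> be a broad subgroup.  The main one (\<open>positive_defect_nonvanishing\<close>): an irreducible
  character in a 2-block of positive defect does not vanish on all involutions, hence is non-zero
  at some element of \<open>E - {\<one>}\<close>.  The other one (\<open>sum_norm_ge_card\<close>): if \<open>\<chi>\<close> is irreducible and
  non-zero somewhere on \<open>E - {\<one>}\<close>, then the sum of \<open>\<bar>\<chi>(e)\<bar>\<^sup>2\<close> over \<open>e \<in> E - {\<one>}\<close> is at least
  \<open>\<bar>E\<bar> - 1\<close>.  On the other hand the sum of \<open>\<bar>\<chi>(e)\<bar>\<^sup>2\<close> over any finite set of irreducible characters is
  at most \<open>\<bar>C(e)\<bar>\<close>, by Bessel's inequality (\<open>sum_norm_le_centralizer\<close>).  Summing over the characters in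
  blocks of positive defect and over \<open>e \<in> E - {\<one>}\<close>, the number of these characters is at most the
  average of \<open>\<bar>C(e)\<bar>\<close>, so it is at most \<open>\<bar>C(e)\<bar>\<close> for some involution \<open>e\<close> in \<open>E\<close>.

  The lower bound comes from the multiplicities \<open>a\<^sub>\<lambda>\<close> of the linear characters \<open>\<lambda>\<close> of \<open>E\<close> in the
  restriction of \<open>\<chi>\<close>: the sum is \<open>\<bar>E\<bar> \<Sum> a\<^sub>\<lambda>\<^sup>2 - (\<Sum> a\<^sub>\<lambda>)\<^sup>2\<close>, that is, the sum of \<open>(a\<^sub>\<lambda> - a\<^sub>\<mu>)\<^sup>2\<close> over
  the pairs \<open>{\<lambda>, \<mu>}\<close>.  The \<open>a\<^sub>\<lambda>\<close> are \<open>\<bar>E\<bar>\<close> integers that are not all equal, so at least \<open>\<bar>E\<bar> - 1\<close>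
  pairs contribute.

  For the main fact, suppose that \<open>\<chi>\<close> vanishes on all involutions, and let \<open>z\<close> be the sum of all
  \<open>s \<in> G\<close> with \<open>s\<^sup>2 = \<one>\<close>.  Then \<open>\<omega>\<^sub>\<chi>(z) = 1\<close>, so \<open>\<omega>\<^sub>\<chi>(z\<^sup>2) = 1\<close>.  The coefficient of \<open>z\<^sup>2\<close> at \<open>g\<close> is the
  number of \<open>s\<close> with \<open>s\<^sup>2 = \<one>\<close> that invert \<open>g\<close>, and this number is even if \<open>\<bar>C(g)\<bar>\<close> is even
  (\<open>sq_coeff_even\<close>).  So modulo a maximal ideal over 2 only classes with \<open>\<bar>C(g)\<bar>\<close> odd contribute.
  For these, \<open>\<bar>C(g)\<bar> \<omega>\<^sub>\<chi>(g) = (\<bar>G\<bar> / \<chi>(\<one>)) \<chi>(g)\<close> would vanish modulo the ideal if \<open>\<bar>G\<bar> / \<chi>(\<one>)\<close>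
  were even.  Hence \<open>\<bar>G\<bar> / \<chi>(\<one>)\<close> is odd (\<open>vanishing_imp_defect_zero\<close>).  Then the central idempotent
  of \<open>\<chi>\<close> has coefficients in the localization and separates \<open>\<chi>\<close> from the other characters, so
  \<open>{\<chi>}\<close> is a block, and its defect group is trivial (\<open>defect_zero_block\<close>).

  The character theory over the complex numbers is built from matrix representations: Schur's
  lemma, the orthogonality of irreducible characters, and the integrality of \<open>\<chi>(g)\<close>, \<open>\<omega>\<^sub>\<chi>(g)\<close> and
  \<open>\<bar>G\<bar> / \<chi>(\<one>)\<close>.
\<close>

section \<open>Traces of matrices\<close>

lemma mat_trace_mult:
  assumes "A \<in> carrier_mat n m" "B \<in> carrier_mat m n"
  shows "mat_trace (A * B) = (\<Sum>i<n. \<Sum>j<m. A $$ (i, j) * B $$ (j, i))"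
  using assms by (auto simp: mat_trace_def scalar_prod_def lessThan_atLeast0 intro!: sum.cong)

lemma mat_trace_mult_commute:
  assumes "A \<in> carrier_mat n m" "B \<in> carrier_mat m n"
  shows "mat_trace (A * B) = mat_trace (B * A)"
  unfolding mat_trace_mult[OF assms] mat_trace_mult[OF assms(2,1)]
  by (subst sum.swap) (simp add: mult.commute)

lemma mat_trace_conj:
  assumes "A \<in> carrier_mat n n" "P \<in> carrier_mat n n" "Q \<in> carrier_mat n n" "Q * P = 1\<^sub>m n"
  shows "mat_trace (P * A * Q) = mat_trace A"
proof -
  have "mat_trace (P * A * Q) = mat_trace (Q * (P * A))"
    using assms by (intro mat_trace_mult_commute) auto
  also have "Q * (P * A) = A"
    using assms assoc_mult_mat[of Q n n P n A n] by simp
  finally show ?thesis .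
qed

lemma upper_triangular_pow:
  fixes T :: "complex mat"
  assumes "T \<in> carrier_mat n n" "upper_triangular T"
  shows "(\<forall>i<n. \<forall>j<i. (T ^\<^sub>m k) $$ (i, j) = 0) \<and> (\<forall>i<n. (T ^\<^sub>m k) $$ (i, i) = (T $$ (i, i)) ^ k)"
proof (induction k)
  case 0
  then show ?case using assms by auto
next
  case (Suc k)
  have T: "T ^\<^sub>m k \<in> carrier_mat n n" using assms by simp
  have *: "(T ^\<^sub>m Suc k) $$ (i, j) = (\<Sum>l<n. (T ^\<^sub>m k) $$ (i, l) * T $$ (l, j))"
    if "i < n" "j < n" for i j
    using that assms(1) T by (simp add: scalar_prod_def lessThan_atLeast0)
  have "(T ^\<^sub>m Suc k) $$ (i, j) = 0" if "i < n" "j < i" for i j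
  proof -
    have "(T ^\<^sub>m k) $$ (i, l) * T $$ (l, j) = 0" if "l < n" for l
      using Suc \<open>i < n\<close> \<open>j < i\<close> that upper_triangularD[OF assms(2), of j l] assms(1)
      by (cases "l < i") auto
    then have "(\<Sum>l<n. (T ^\<^sub>m k) $$ (i, l) * T $$ (l, j)) = 0" by (intro sum.neutral) simp
    then show ?thesis using that by (simp add: *[of i j] del: pow_mat.simps)
  qed
  moreover have "(T ^\<^sub>m Suc k) $$ (i, i) = (T $$ (i, i)) ^ Suc k" if "i < n" for i
  proof -
    have "(T ^\<^sub>m k) $$ (i, l) * T $$ (l, i) = (if l = i then (T $$ (i, i)) ^ Suc k else 0)"
      if "l < n" for l
      using Suc \<open>i < n\<close> that upper_triangularD[OF assms(2), of i l] assms(1)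
      by (cases l i rule: linorder_cases) (auto simp: mult.commute)
    then have "(\<Sum>l<n. (T ^\<^sub>m k) $$ (i, l) * T $$ (l, i)) =
        (\<Sum>l<n. if l = i then (T $$ (i, i)) ^ Suc k else 0)"
      by (intro sum.cong) simp_all
    then have "(T ^\<^sub>m Suc k) $$ (i, i) = (\<Sum>l<n. if l = i then (T $$ (i, i)) ^ Suc k else 0)"
      using that by (simp only: *[of i i])
    then show ?thesis using that by simp
  qed
  ultimately show ?case by blast
qed

text \<open>The \<open>d i\<close> are the eigenvalues of \<open>A\<close> with multiplicity, read off the diagonal of a triangular
  matrix similar to \<open>A\<close>.  Any relation between two powers of \<open>A\<close> passes to them, which is how
  idempotents and matrices of finite order are treated below.\<close>

lemma eigenvalue_list:
  fixes A :: "complex mat"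
  assumes A: "A \<in> carrier_mat n n"
  obtains d :: "nat \<Rightarrow> complex"
  where "\<And>k. mat_trace (A ^\<^sub>m k) = (\<Sum>i<n. d i ^ k)"
    and "\<And>i k l. i < n \<Longrightarrow> A ^\<^sub>m k = A ^\<^sub>m l \<Longrightarrow> d i ^ k = d i ^ l"
proof -
  obtain as where "char_poly A = (\<Prod>a\<leftarrow>as. [:- a, 1:])"
    using char_poly_factorized[OF A] by blast
  then obtain T where T: "T \<in> carrier_mat n n" "upper_triangular T" and "similar_mat A T"
    using schur_decomposition_exists[OF A] by blast
  then obtain P Q where sim: "similar_mat_wit A T P Q"
    unfolding similar_mat_def by blast
  note PQ = similar_mat_witD2[OF A sim]
  note pow = upper_triangular_pow[OF T]
  have Tk: "T ^\<^sub>m k \<in> carrier_mat n n" for k using T by simp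
  have "mat_trace (A ^\<^sub>m k) = (\<Sum>i<n. (T $$ (i, i)) ^ k)" for k
  proof -
    have "mat_trace (A ^\<^sub>m k) = mat_trace (T ^\<^sub>m k)"
      using similar_mat_wit_pow_id[OF sim, of k] PQ mat_trace_conj[OF Tk, of P Q k] by simp
    also have "\<dots> = (\<Sum>i<n. (T $$ (i, i)) ^ k)"
      using pow T(1) unfolding mat_trace_def by simp
    finally show ?thesis .
  qed
  moreover have "(T $$ (i, i)) ^ k = (T $$ (i, i)) ^ l"
    if "i < n" "A ^\<^sub>m k = A ^\<^sub>m l" for i k l
  proof -
    have "T ^\<^sub>m k = Q * A ^\<^sub>m k * P" for k
      using similar_mat_wit_pow_id[OF similar_mat_wit_sym[OF sim]] .
    then have "T ^\<^sub>m k = T ^\<^sub>m l" using that(2) by simp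
    then show ?thesis using pow that(1) by metis
  qed
  ultimately show ?thesis by (rule that)
qed

lemma mat_trace_idempotent:
  fixes P :: "complex mat"
  assumes "P \<in> carrier_mat n n" "P * P = P"
  shows "mat_trace P \<in> \<int>"
proof -
  obtain d where d: "\<And>k. mat_trace (P ^\<^sub>m k) = (\<Sum>i<n. d i ^ k)"
    "\<And>i k l. i < n \<Longrightarrow> P ^\<^sub>m k = P ^\<^sub>m l \<Longrightarrow> d i ^ k = d i ^ l"
    using eigenvalue_list[OF assms(1)] by metis
  have 1: "P ^\<^sub>m 1 = P" using assms by simp
  have "P ^\<^sub>m 2 = P ^\<^sub>m 1" using assms by (simp add: numeral_2_eq_2)
  then have "d i ^ 2 = d i ^ 1" if "i < n" for i using d(2) that by blast
  then have "d i = 0 \<or> d i = 1" if "i < n" for i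
    using that by (auto simp: power2_eq_square)
  then have "(\<Sum>i<n. d i ^ 1) \<in> \<int>" by (intro Ints_sum) force
  then show ?thesis using d(1)[of 1] 1 by simp
qed

lemma algebraic_int_root_of_unity:
  fixes z :: complex
  assumes "z ^ m = 1" "0 < m"
  shows "algebraic_int z"
proof (rule algebraic_int_root[of 1 "monom 1 m"])
  show "poly (monom 1 m) z = 1" using assms by (simp add: poly_monom)
  show "\<forall>i. coeff (monom 1 m) i \<in> (\<int> :: complex set)" by simp
  show "lead_coeff (monom 1 m) = (1 :: complex)" "degree (monom (1 :: complex) m) > 0"
    using assms by (simp_all add: degree_monom_eq)
qed simp

lemma algebraic_int_sum:
  fixes f :: "'b \<Rightarrow> complex"
  assumes "\<And>i. i \<in> I \<Longrightarrow> algebraic_int (f i)"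
  shows "algebraic_int (sum f I)"
  using assms by (induction I rule: infinite_finite_induct) (auto simp: algebraic_int_add_mult)

lemma mat_trace_finite_order:
  fixes A :: "complex mat"
  assumes "A \<in> carrier_mat n n" "A ^\<^sub>m m = 1\<^sub>m n" "0 < m"
  shows "algebraic_int (mat_trace A)" "mat_trace (A ^\<^sub>m (m - 1)) = cnj (mat_trace A)"
proof -
  obtain d where d: "\<And>k. mat_trace (A ^\<^sub>m k) = (\<Sum>i<n. d i ^ k)"
    "\<And>i k l. i < n \<Longrightarrow> A ^\<^sub>m k = A ^\<^sub>m l \<Longrightarrow> d i ^ k = d i ^ l"
    using eigenvalue_list[OF assms(1)] by metis
  have tr: "mat_trace A = (\<Sum>i<n. d i)" using d(1)[of 1] assms(1) by simp
  have "A ^\<^sub>m m = A ^\<^sub>m 0" using assms by simp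
  then have "d i ^ m = d i ^ 0" if "i < n" for i
    using d(2)[OF that] by blast
  then have dm: "d i ^ m = 1" if "i < n" for i using that by simp
  then show "algebraic_int (mat_trace A)"
    unfolding tr using algebraic_int_root_of_unity[OF dm assms(3)] by (intro algebraic_int_sum) simp
  have "d i ^ (m - 1) = cnj (d i)" if "i < n" for i
  proof -
    have "norm (d i) = 1"
      using power_eq_1_iff[OF dm[OF that]] assms(3) by simp
    then have "d i * cnj (d i) = 1"
      by (simp add: complex_norm_square[symmetric])
    moreover have "d i * d i ^ (m - 1) = 1"
      using dm[OF that] assms(3) by (simp add: power_eq_if)
    ultimately have "d i * d i ^ (m - 1) = d i * cnj (d i)" by simp
    moreover have "d i \<noteq> 0" using \<open>norm (d i) = 1\<close> by auto
    ultimately show ?thesis by simp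
  qed
  then show "mat_trace (A ^\<^sub>m (m - 1)) = cnj (mat_trace A)"
    unfolding tr d(1) by simp
qed

section \<open>Schur's lemma\<close>

lemma mat_mult_unit_vec:
  fixes A :: "complex mat"
  assumes "A \<in> carrier_mat n m" "j < m"
  shows "A *\<^sub>v unit_vec m j = col A j"
  using assms by (intro eq_vecI) auto

lemma mat_eq_by_vec:
  fixes A B :: "complex mat"
  assumes "A \<in> carrier_mat n m" "B \<in> carrier_mat n m"
    and "\<And>v. v \<in> carrier_vec m \<Longrightarrow> A *\<^sub>v v = B *\<^sub>v v"
  shows "A = B"
proof (rule eq_matI)
  fix i j assume ij: "i < dim_row B" "j < dim_col B"
  then have "col A j = col B j"
    using assms(3)[of "unit_vec m j"] assms(1,2) mat_mult_unit_vec by (metis carrier_matD(2) unit_vec_carrier)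
  moreover have "A $$ (i, j) = col A j $ i" "B $$ (i, j) = col B j $ i"
    using ij assms(1,2) by auto
  ultimately show "A $$ (i, j) = B $$ (i, j)" by simp
qed (use assms in auto)

lemma subspace_vecI:
  assumes "W \<subseteq> carrier_vec n" "0\<^sub>v n \<in> W"
    and "\<And>v w. v \<in> W \<Longrightarrow> w \<in> W \<Longrightarrow> v + w \<in> W"
    and "\<And>c v. v \<in> W \<Longrightarrow> c \<cdot>\<^sub>v v \<in> W"
  shows "subspace class_ring W (module_vec TYPE(complex) n)"
  unfolding subspace_def submodule_def
  using assms vec_vs vec_module by (auto simp: module_vec_simps)

text \<open>Finite groups.  Representations are given by their matrices, and sums of matrices over the
  group are formed entry by entry.\<close>

locale fin_group = group G for G (structure) +
  assumes fin: "finite (carrier G)"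
begin

lemma rep_pos: "irreducible_rep G n \<rho> \<Longrightarrow> 0 < n"
  by (simp add: irreducible_rep_def)

lemma rep_carrier:
  assumes "irreducible_rep G n \<rho>" "g \<in> carrier G"
  shows "\<rho> g \<in> carrier_mat n n"
proof -
  have "\<rho> g \<in> Units (ring_mat TYPE(complex) n ())"
    using assms by (auto simp: irreducible_rep_def hom_def GL_def units_of_def)
  then show ?thesis by (auto simp: Units_def ring_mat_simps)
qed

lemma rep_mult:
  assumes "irreducible_rep G n \<rho>" "g \<in> carrier G" "h \<in> carrier G"
  shows "\<rho> (g \<otimes> h) = \<rho> g * \<rho> h"
  using assms by (auto simp: irreducible_rep_def hom_def GL_def units_of_def ring_mat_simps)

lemma rep_one:
  assumes "irreducible_rep G n \<rho>"
  shows "\<rho> \<one> = 1\<^sub>m n"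
proof -
  interpret R: ring "ring_mat TYPE(complex) n ()" by (rule ring_mat)
  have "group_hom G (GL n) \<rho>"
    using assms R.units_group is_group
    by (auto simp: group_hom_def group_hom_axioms_def irreducible_rep_def GL_def)
  then show ?thesis
    using group_hom.hom_one[of G "GL n" \<rho>] by (simp add: GL_def units_of_def ring_mat_simps)
qed

lemma rep_dim:
  assumes "irreducible_rep G n \<rho>" "g \<in> carrier G"
  shows "dim_row (\<rho> g) = n" "dim_col (\<rho> g) = n"
  using rep_carrier[OF assms] by auto

lemma rep_vec:
  assumes "irreducible_rep G n \<rho>" "g \<in> carrier G" "v \<in> carrier_vec n"
  shows "\<rho> g *\<^sub>v v \<in> carrier_vec n"
  using rep_carrier[OF assms(1,2)] assms(3) by (rule mult_mat_vec_carrier)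

lemma rep_mult_entry:
  assumes "irreducible_rep G n \<rho>" "g \<in> carrier G" "h \<in> carrier G" "i < n" "j < n"
  shows "\<rho> (g \<otimes> h) $$ (i, j) = (\<Sum>k<n. \<rho> g $$ (i, k) * \<rho> h $$ (k, j))"
  using assms rep_carrier[OF assms(1)]
  by (simp add: rep_mult[OF assms(1)] rep_dim[OF assms(1)] scalar_prod_def lessThan_atLeast0)

lemma rep_pow:
  assumes "irreducible_rep G n \<rho>" "g \<in> carrier G"
  shows "\<rho> (g [^] k) = \<rho> g ^\<^sub>m (k::nat)"
  using assms by (induction k) (auto simp: rep_one rep_mult rep_dim)

lemma irreducible_rep_invariant:
  assumes "irreducible_rep G n \<rho>"
    and "W \<subseteq> carrier_vec n" "0\<^sub>v n \<in> W"
    and "\<And>v w. v \<in> W \<Longrightarrow> w \<in> W \<Longrightarrow> v + w \<in> W"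
    and "\<And>c v. v \<in> W \<Longrightarrow> c \<cdot>\<^sub>v v \<in> W"
    and "\<And>g w. g \<in> carrier G \<Longrightarrow> w \<in> W \<Longrightarrow> \<rho> g *\<^sub>v w \<in> W"
  shows "W = {0\<^sub>v n} \<or> W = carrier_vec n"
  using assms(1,6) subspace_vecI[OF assms(2-5)] unfolding irreducible_rep_def by blast

text \<open>Schur's lemma: a non-zero intertwiner is invertible, since its kernel and its image are
  invariant.  So it is zero if the characters differ, and a scalar if the representations agree.\<close>

lemma schur_iso:
  assumes \<rho>: "irreducible_rep G n \<rho>" and \<sigma>: "irreducible_rep G m \<sigma>"
    and A: "A \<in> carrier_mat n m" and "A \<noteq> 0\<^sub>m n m"
    and comm: "\<And>g. g \<in> carrier G \<Longrightarrow> \<rho> g * A = A * \<sigma> g"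
  obtains B where "B \<in> carrier_mat m n" "A * B = 1\<^sub>m n" "B * A = 1\<^sub>m m"
proof -
  define K where "K = {v \<in> carrier_vec m. A *\<^sub>v v = 0\<^sub>v n}"
  define I where "I = (\<lambda>v. A *\<^sub>v v) ` carrier_vec m"
  have vec_comm: "\<rho> g *\<^sub>v (A *\<^sub>v v) = A *\<^sub>v (\<sigma> g *\<^sub>v v)" if "g \<in> carrier G" "v \<in> carrier_vec m" for g v
    using that comm A rep_carrier[OF \<rho>] rep_carrier[OF \<sigma>] by (metis assoc_mult_mat_vec)
  have "K = {0\<^sub>v m} \<or> K = carrier_vec m"
  proof (rule irreducible_rep_invariant[OF \<sigma>])
    show "\<sigma> g *\<^sub>v w \<in> K" if "g \<in> carrier G" "w \<in> K" for g w
    proof -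
      have w: "w \<in> carrier_vec m" "A *\<^sub>v w = 0\<^sub>v n" using that by (auto simp: K_def)
      have "A *\<^sub>v (\<sigma> g *\<^sub>v w) = \<rho> g *\<^sub>v 0\<^sub>v n" using vec_comm[OF that(1) w(1)] w(2) by simp
      also have "\<dots> = 0\<^sub>v n" using rep_carrier[OF \<rho> that(1)] by auto
      finally show ?thesis using rep_vec[OF \<sigma> that(1) w(1)] by (simp add: K_def)
    qed
  qed (use A in \<open>auto simp: K_def mult_add_distrib_mat_vec mult_mat_vec\<close>)
  moreover have "K \<noteq> carrier_vec m"
  proof
    assume "K = carrier_vec m"
    then have Av: "A *\<^sub>v v = 0\<^sub>v n" if "v \<in> carrier_vec m" for v
      using that unfolding K_def by blast
    have "A = 0\<^sub>m n m"
    proof (rule mat_eq_by_vec[OF A])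
      show "A *\<^sub>v v = 0\<^sub>m n m *\<^sub>v v" if "v \<in> carrier_vec m" for v
        using Av[OF that] that by (intro eq_vecI) auto
    qed simp
    then show False using assms by simp
  qed
  ultimately have K: "K = {0\<^sub>v m}" by blast
  have "I = {0\<^sub>v n} \<or> I = carrier_vec n"
  proof (rule irreducible_rep_invariant[OF \<rho>])
    show "I \<subseteq> carrier_vec n" using A by (auto simp: I_def)
    have "A *\<^sub>v 0\<^sub>v m = 0\<^sub>v n" using A by auto
    then show "0\<^sub>v n \<in> I" unfolding I_def by (metis image_eqI zero_carrier_vec)
    show "v + w \<in> I" if "v \<in> I" "w \<in> I" for v w
      using that A unfolding I_def by (auto simp: mult_add_distrib_mat_vec[symmetric])
    show "c \<cdot>\<^sub>v v \<in> I" if "v \<in> I" for c v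
      using that A unfolding I_def by (auto simp: mult_mat_vec[symmetric])
    show "\<rho> g *\<^sub>v w \<in> I" if "g \<in> carrier G" "w \<in> I" for g w
      using that vec_comm rep_vec[OF \<sigma>] unfolding I_def by auto
  qed
  moreover have "I \<noteq> {0\<^sub>v n}"
  proof
    assume "I = {0\<^sub>v n}"
    then have "K = carrier_vec m" by (auto simp: I_def K_def)
    then show False using \<open>K \<noteq> carrier_vec m\<close> by simp
  qed
  ultimately have "I = carrier_vec n" by blast
  then have "\<exists>w. w \<in> carrier_vec m \<and> A *\<^sub>v w = unit_vec n j" for j
    by (metis I_def imageE unit_vec_carrier)
  then obtain w where w: "\<And>j. w j \<in> carrier_vec m" "\<And>j. A *\<^sub>v w j = unit_vec n j" by metis
  define B where "B = mat_of_cols m (map w [0..<n])"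
  have B: "B \<in> carrier_mat m n" by (auto simp: B_def)
  have colB: "col B j = w j" if "j < n" for j
    using that w by (simp add: B_def)
  have AB: "A * B = 1\<^sub>m n"
  proof (rule mat_col_eqI)
    fix j assume "j < dim_col (1\<^sub>m n :: complex mat)"
    then have j: "j < n" by simp
    then have "col (A * B) j = A *\<^sub>v col B j" using A B by auto
    then show "col (A * B) j = col (1\<^sub>m n) j" using j colB w by simp
  qed (use A B in auto)
  have "B * A = 1\<^sub>m m"
  proof (rule mat_eq_by_vec)
    fix v :: "complex vec" assume v: "v \<in> carrier_vec m"
    have BA: "B * A \<in> carrier_mat m m" using A B by auto
    have "A *\<^sub>v (B *\<^sub>v (A *\<^sub>v v)) = (A * B) *\<^sub>v (A *\<^sub>v v)"
      using A B v by (intro assoc_mult_mat_vec[symmetric]) auto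
    then have eq: "A *\<^sub>v (B *\<^sub>v (A *\<^sub>v v)) = A *\<^sub>v v" using AB A v by simp
    have cl: "B *\<^sub>v (A *\<^sub>v v) \<in> carrier_vec m" using A B v by simp
    have "A *\<^sub>v (B *\<^sub>v (A *\<^sub>v v) - v) = 0\<^sub>v n"
      using A cl v eq by (simp add: mult_minus_distrib_mat_vec)
    then have "B *\<^sub>v (A *\<^sub>v v) - v \<in> K" using cl v by (auto simp: K_def)
    then have 0: "B *\<^sub>v (A *\<^sub>v v) - v = 0\<^sub>v m" using K by simp
    have "B *\<^sub>v (A *\<^sub>v v) = v"
    proof (rule eq_vecI)
      fix i assume i: "i < dim_vec v"
      then have "(B *\<^sub>v (A *\<^sub>v v) - v) $ i = 0" using 0 v by simp
      then show "(B *\<^sub>v (A *\<^sub>v v)) $ i = v $ i" using i cl v by simp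
    qed (use B v in simp)
    then show "B * A *\<^sub>v v = 1\<^sub>m m *\<^sub>v v"
      using A B v by (simp add: assoc_mult_mat_vec)
  qed (use A B in auto)
  then show ?thesis using that B AB by blast
qed

lemma schur_zero:
  assumes \<rho>: "irreducible_rep G n \<rho>" and \<sigma>: "irreducible_rep G m \<sigma>"
    and A: "A \<in> carrier_mat n m"
    and comm: "\<And>g. g \<in> carrier G \<Longrightarrow> \<rho> g * A = A * \<sigma> g"
    and "g \<in> carrier G" "mat_trace (\<rho> g) \<noteq> mat_trace (\<sigma> g)"
  shows "A = 0\<^sub>m n m"
proof (rule ccontr)
  assume "A \<noteq> 0\<^sub>m n m"
  then obtain B where B: "B \<in> carrier_mat m n" "A * B = 1\<^sub>m n" "B * A = 1\<^sub>m m"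
    using schur_iso[OF \<rho> \<sigma> A _ comm] by blast
  have r: "\<rho> g \<in> carrier_mat n n" "\<sigma> g \<in> carrier_mat m m"
    using assms rep_carrier by blast+
  have "\<rho> g = \<rho> g * (A * B)" using B r by simp
  also have "\<dots> = A * \<sigma> g * B"
    using comm[OF assms(5)] assoc_mult_mat[OF r(1) A B(1)] by simp
  finally have "mat_trace (\<rho> g) = mat_trace (B * (A * \<sigma> g))"
    using mat_trace_mult_commute[of "A * \<sigma> g" n m B] A B r by simp
  also have "B * (A * \<sigma> g) = \<sigma> g"
    using assoc_mult_mat[OF B(1) A r(2)] B r by simp
  finally show False using assms by simp
qed

lemma schur_scalar:
  assumes \<rho>: "irreducible_rep G n \<rho>" and A: "A \<in> carrier_mat n n"
    and comm: "\<And>g. g \<in> carrier G \<Longrightarrow> \<rho> g * A = A * \<rho> g"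
  obtains c where "A = c \<cdot>\<^sub>m 1\<^sub>m n"
proof -
  obtain c where "c \<in> spectrum A"
    using spectrum_non_empty[OF A rep_pos[OF \<rho>]] by blast
  then obtain v where v: "v \<in> carrier_vec n" "v \<noteq> 0\<^sub>v n" "A *\<^sub>v v = c \<cdot>\<^sub>v v"
    using A by (auto simp: spectrum_def eigenvalue_def eigenvector_def)
  define W where "W = {v \<in> carrier_vec n. A *\<^sub>v v = c \<cdot>\<^sub>v v}"
  have "W = {0\<^sub>v n} \<or> W = carrier_vec n"
  proof (rule irreducible_rep_invariant[OF \<rho>])
    show "\<rho> g *\<^sub>v w \<in> W" if "g \<in> carrier G" "w \<in> W" for g w
    proof -
      have r: "\<rho> g \<in> carrier_mat n n" and w: "w \<in> carrier_vec n" "A *\<^sub>v w = c \<cdot>\<^sub>v w"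
        using that rep_carrier[OF \<rho>] by (auto simp: W_def)
      have "A *\<^sub>v (\<rho> g *\<^sub>v w) = \<rho> g *\<^sub>v (A *\<^sub>v w)"
        using assoc_mult_mat_vec[OF A r w(1)] assoc_mult_mat_vec[OF r A w(1)] comm[OF that(1)] by simp
      then show ?thesis using r w by (simp add: W_def mult_mat_vec)
    qed
  qed (use A in \<open>auto simp: W_def mult_add_distrib_mat_vec mult_mat_vec smult_add_distrib_vec smult_smult_assoc mult.commute\<close>)
  moreover have "v \<in> W" using v by (simp add: W_def)
  ultimately have W: "W = carrier_vec n" using v by blast
  have "A = c \<cdot>\<^sub>m 1\<^sub>m n"
  proof (rule mat_eq_by_vec)
    show "A *\<^sub>v u = c \<cdot>\<^sub>m 1\<^sub>m n *\<^sub>v u" if "u \<in> carrier_vec n" for u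
    proof -
      have "u \<in> W" using W that by simp
      moreover have "c \<cdot>\<^sub>m 1\<^sub>m n *\<^sub>v u = c \<cdot>\<^sub>v u"
        using that by (intro eq_vecI) auto
      ultimately show ?thesis by (simp add: W_def)
    qed
  qed (use A in auto)
  then show ?thesis by (rule that)
qed

section \<open>Irreducible characters\<close>


lemma inv_cancel:
  assumes "h \<in> carrier G" "g \<in> carrier G"
  shows "inv h \<otimes> (h \<otimes> g) = g" "h \<otimes> (inv h \<otimes> g) = g"
  using assms by (simp_all add: m_assoc[symmetric])

lemma sum_translate:
  assumes "h \<in> carrier G"
  shows "(\<Sum>g\<in>carrier G. f (h \<otimes> g)) = (\<Sum>g\<in>carrier G. f g)"
  by (rule sum.reindex_bij_witness[of _ "\<lambda>g. inv h \<otimes> g" "\<lambda>g. h \<otimes> g"])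
    (use assms in \<open>auto simp: m_assoc[symmetric]\<close>)

lemma sum_conjugate:
  assumes "h \<in> carrier G"
  shows "(\<Sum>g\<in>carrier G. f (h \<otimes> g \<otimes> inv h)) = (\<Sum>g\<in>carrier G. f g)"
  by (rule sum.reindex_bij_witness[of _ "\<lambda>g. inv h \<otimes> g \<otimes> h" "\<lambda>g. h \<otimes> g \<otimes> inv h"])
    (use assms in \<open>auto simp: m_assoc inv_cancel\<close>)

lemma order_pos: "0 < Coset.order G"
  using fin one_closed unfolding Coset.order_def by (auto simp: card_gt_0_iff)

text \<open>Averaging the matrix unit \<open>E\<^sub>j\<^sub>k\<close> over \<open>G\<close> gives the intertwiner \<open>\<Sum>\<^sub>g \<rho>(g) E\<^sub>j\<^sub>k \<sigma>(g\<inverse>)\<close>; its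
  entries yield the orthogonality relations.\<close>

lemma rep_average_comm:
  assumes \<rho>: "irreducible_rep G n \<rho>" and \<sigma>: "irreducible_rep G m \<sigma>"
    and jk: "j < n" "k < m" and h: "h \<in> carrier G"
  defines "A \<equiv> mat n m (\<lambda>(i, l). \<Sum>g\<in>carrier G. \<rho> g $$ (i, j) * \<sigma> (inv g) $$ (k, l))"
  shows "\<rho> h * A = A * \<sigma> h"
proof (rule eq_matI)
  fix i l assume "i < dim_row (A * \<sigma> h)" "l < dim_col (A * \<sigma> h)"
  then have i: "i < n" and l: "l < m" using h rep_dim[OF \<sigma>] by (auto simp: A_def)
  have "(\<rho> h * A) $$ (i, l) =
      (\<Sum>p<n. \<rho> h $$ (i, p) * (\<Sum>g\<in>carrier G. \<rho> g $$ (p, j) * \<sigma> (inv g) $$ (k, l)))"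
    using i l h rep_dim[OF \<rho>] by (simp add: A_def scalar_prod_def lessThan_atLeast0)
  also have "\<dots> = (\<Sum>g\<in>carrier G. (\<Sum>p<n. \<rho> h $$ (i, p) * \<rho> g $$ (p, j)) * \<sigma> (inv g) $$ (k, l))"
    by (simp add: sum_distrib_left sum_distrib_right mult.assoc) (rule sum.swap)
  also have "\<dots> = (\<Sum>g\<in>carrier G. \<rho> (h \<otimes> g) $$ (i, j) * \<sigma> (inv (h \<otimes> g) \<otimes> h) $$ (k, l))"
    using i jk h by (intro sum.cong) (auto simp: rep_mult_entry[OF \<rho>] inv_mult_group m_assoc)
  also have "\<dots> = (\<Sum>g\<in>carrier G. \<rho> g $$ (i, j) * \<sigma> (inv g \<otimes> h) $$ (k, l))"
    using sum_translate[OF h, of "\<lambda>g. \<rho> g $$ (i, j) * \<sigma> (inv g \<otimes> h) $$ (k, l)"] .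
  also have "\<dots> = (\<Sum>g\<in>carrier G. \<Sum>p<m. \<rho> g $$ (i, j) * \<sigma> (inv g) $$ (k, p) * \<sigma> h $$ (p, l))"
    using l jk h by (intro sum.cong) (auto simp: rep_mult_entry[OF \<sigma>] sum_distrib_left mult.assoc)
  also have "\<dots> = (A * \<sigma> h) $$ (i, l)"
    using i l h rep_dim[OF \<sigma>]
    by (subst sum.swap) (simp add: A_def scalar_prod_def lessThan_atLeast0 sum_distrib_right)
  finally show "(\<rho> h * A) $$ (i, l) = (A * \<sigma> h) $$ (i, l)" .
qed (use h rep_dim[OF \<rho>] rep_dim[OF \<sigma>] in \<open>auto simp: A_def\<close>)

lemma rep_orthogonal:
  assumes \<rho>: "irreducible_rep G n \<rho>" and \<sigma>: "irreducible_rep G m \<sigma>"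
    and "x \<in> carrier G" "mat_trace (\<rho> x) \<noteq> mat_trace (\<sigma> x)"
    and jk: "i < n" "j < n" "k < m" "l < m"
  shows "(\<Sum>g\<in>carrier G. \<rho> g $$ (i, j) * \<sigma> (inv g) $$ (k, l)) = 0"
proof -
  define A where "A = mat n m (\<lambda>(i, l). \<Sum>g\<in>carrier G. \<rho> g $$ (i, j) * \<sigma> (inv g) $$ (k, l))"
  have "A = 0\<^sub>m n m"
    using rep_average_comm[OF \<rho> \<sigma> jk(2,3)] unfolding A_def
    by (intro schur_zero[OF \<rho> \<sigma> _ _ assms(3,4)]) auto
  then have "A $$ (i, l) = 0" using jk by simp
  then show ?thesis using jk by (simp add: A_def)
qed

lemma rep_orthogonal_self:
  assumes \<rho>: "irreducible_rep G n \<rho>" and jk: "i < n" "j < n" "k < n" "l < n"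
  shows "(\<Sum>g\<in>carrier G. \<rho> g $$ (i, j) * \<rho> (inv g) $$ (k, l)) =
    (if i = l \<and> j = k then of_nat (Coset.order G) / of_nat n else 0)"
proof -
  define A where "A = mat n n (\<lambda>(i, l). \<Sum>g\<in>carrier G. \<rho> g $$ (i, j) * \<rho> (inv g) $$ (k, l))"
  obtain c where c: "A = c \<cdot>\<^sub>m 1\<^sub>m n"
    using rep_average_comm[OF \<rho> \<rho> jk(2,3)] unfolding A_def
    by (elim schur_scalar[OF \<rho>, rotated 2]) auto
  have entry: "(\<Sum>g\<in>carrier G. \<rho> g $$ (i, j) * \<rho> (inv g) $$ (k, l)) = (if i = l then c else 0)"
    if "i < n" "l < n" for i l
  proof -
    have "A $$ (i, l) = (if i = l then c else 0)" using that by (simp add: c)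
    then show ?thesis using that by (simp add: A_def)
  qed
  have "of_nat n * c = (\<Sum>i<n. \<Sum>g\<in>carrier G. \<rho> g $$ (i, j) * \<rho> (inv g) $$ (k, i))"
    by (simp add: entry)
  also have "\<dots> = (\<Sum>g\<in>carrier G. \<rho> (inv g \<otimes> g) $$ (k, j))"
  proof (subst sum.swap, rule sum.cong)
    fix g assume g: "g \<in> carrier G"
    then have "\<rho> (inv g \<otimes> g) $$ (k, j) = (\<Sum>i<n. \<rho> (inv g) $$ (k, i) * \<rho> g $$ (i, j))"
      using jk by (intro rep_mult_entry[OF \<rho>]) auto
    then show "(\<Sum>i<n. \<rho> g $$ (i, j) * \<rho> (inv g) $$ (k, i)) = \<rho> (inv g \<otimes> g) $$ (k, j)"
      by (simp only: mult.commute)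
  qed simp
  also have "\<dots> = (\<Sum>g\<in>carrier G. if j = k then 1 else 0)"
    using jk by (intro sum.cong) (auto simp: rep_one[OF \<rho>])
  also have "\<dots> = (if j = k then of_nat (Coset.order G) else 0)"
    by (simp add: Coset.order_def)
  finally have "c = (if j = k then of_nat (Coset.order G) / of_nat n else 0)"
    using rep_pos[OF \<rho>] by (simp add: field_simps split: if_splits)
  then show ?thesis using entry[OF jk(1,4)] by simp
qed

lemma IrrE:
  assumes "\<chi> \<in> Irr G"
  obtains n \<rho> where "irreducible_rep G n \<rho>" "\<And>g. g \<in> carrier G \<Longrightarrow> \<chi> g = mat_trace (\<rho> g)"
    "\<And>g. g \<in> carrier G \<Longrightarrow> \<chi> g = (\<Sum>i<n. \<rho> g $$ (i, i))" "\<chi> \<one> = of_nat n" "0 < n"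
proof -
  obtain n \<rho> where \<rho>: "irreducible_rep G n \<rho>" and \<chi>: "\<chi> = (\<lambda>g\<in>carrier G. mat_trace (\<rho> g))"
    using assms unfolding Irr_def by blast
  have *: "\<chi> g = (\<Sum>i<n. \<rho> g $$ (i, i))" if "g \<in> carrier G" for g
    using that rep_dim[OF \<rho>] by (simp add: \<chi> mat_trace_def)
  have "\<chi> \<one> = of_nat n" by (simp add: * rep_one[OF \<rho>])
  then show ?thesis using that[OF \<rho> _ *] rep_pos[OF \<rho>] by (simp add: \<chi>)
qed

lemma Irr_eqI:
  assumes "\<chi> \<in> Irr G" "\<psi> \<in> Irr G" "\<And>g. g \<in> carrier G \<Longrightarrow> \<chi> g = \<psi> g"
  shows "\<chi> = \<psi>"
  using assms by (force simp: Irr_def restrict_def fun_eq_iff)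

theorem Irr_orthogonal:
  assumes \<chi>: "\<chi> \<in> Irr G" and \<psi>: "\<psi> \<in> Irr G" and "\<chi> \<noteq> \<psi>"
  shows "(\<Sum>g\<in>carrier G. \<chi> g * \<psi> (inv g)) = 0"
proof -
  obtain n \<rho> where \<rho>: "irreducible_rep G n \<rho>" "\<And>g. g \<in> carrier G \<Longrightarrow> \<chi> g = mat_trace (\<rho> g)"
    "\<And>g. g \<in> carrier G \<Longrightarrow> \<chi> g = (\<Sum>i<n. \<rho> g $$ (i, i))"
    using IrrE[OF \<chi>] by metis
  obtain m \<sigma> where \<sigma>: "irreducible_rep G m \<sigma>" "\<And>g. g \<in> carrier G \<Longrightarrow> \<psi> g = mat_trace (\<sigma> g)"
    "\<And>g. g \<in> carrier G \<Longrightarrow> \<psi> g = (\<Sum>i<m. \<sigma> g $$ (i, i))"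
    using IrrE[OF \<psi>] by metis
  obtain x where x: "x \<in> carrier G" "mat_trace (\<rho> x) \<noteq> mat_trace (\<sigma> x)"
    using Irr_eqI[OF \<chi> \<psi>] assms(3) \<rho>(2) \<sigma>(2) by metis
  have "(\<Sum>g\<in>carrier G. \<chi> g * \<psi> (inv g)) =
      (\<Sum>g\<in>carrier G. \<Sum>i<n. \<Sum>k<m. \<rho> g $$ (i, i) * \<sigma> (inv g) $$ (k, k))"
    by (intro sum.cong) (auto simp: \<rho>(3) \<sigma>(3) sum_product)
  also have "\<dots> = (\<Sum>i<n. \<Sum>k<m. \<Sum>g\<in>carrier G. \<rho> g $$ (i, i) * \<sigma> (inv g) $$ (k, k))"
    by (subst sum.swap, intro sum.cong refl sum.swap)
  also have "\<dots> = 0"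
    using rep_orthogonal[OF \<rho>(1) \<sigma>(1) x] by simp
  finally show ?thesis .
qed

theorem Irr_norm:
  assumes \<chi>: "\<chi> \<in> Irr G"
  shows "(\<Sum>g\<in>carrier G. \<chi> g * \<chi> (inv g)) = of_nat (Coset.order G)"
proof -
  obtain n \<rho> where \<rho>: "irreducible_rep G n \<rho>"
    "\<And>g. g \<in> carrier G \<Longrightarrow> \<chi> g = (\<Sum>i<n. \<rho> g $$ (i, i))" "0 < n"
    using IrrE[OF \<chi>] by metis
  have "(\<Sum>g\<in>carrier G. \<chi> g * \<chi> (inv g)) =
      (\<Sum>g\<in>carrier G. \<Sum>i<n. \<Sum>k<n. \<rho> g $$ (i, i) * \<rho> (inv g) $$ (k, k))"
    by (intro sum.cong) (auto simp: \<rho>(2) sum_product)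
  also have "\<dots> = (\<Sum>i<n. \<Sum>k<n. \<Sum>g\<in>carrier G. \<rho> g $$ (i, i) * \<rho> (inv g) $$ (k, k))"
    by (subst sum.swap, intro sum.cong refl sum.swap)
  also have "\<dots> = (\<Sum>i<n. \<Sum>k<n. if i = k then of_nat (Coset.order G) / of_nat n else 0)"
    using rep_orthogonal_self[OF \<rho>(1)] by (intro sum.cong) auto
  also have "\<dots> = of_nat (Coset.order G)" using \<rho>(3) by simp
  finally show ?thesis .
qed

lemma Irr_degree:
  assumes "\<chi> \<in> Irr G"
  obtains n where "0 < n" "\<chi> \<one> = of_nat n"
  using IrrE[OF assms] by metis

lemma Irr_conj:
  assumes "\<chi> \<in> Irr G" "g \<in> carrier G" "h \<in> carrier G"
  shows "\<chi> (h \<otimes> g \<otimes> inv h) = \<chi> g"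
proof -
  obtain n \<rho> where \<rho>: "irreducible_rep G n \<rho>" "\<And>g. g \<in> carrier G \<Longrightarrow> \<chi> g = mat_trace (\<rho> g)"
    using IrrE[OF assms(1)] by metis
  have "\<rho> (inv h) * \<rho> h = 1\<^sub>m n"
    using assms rep_mult[OF \<rho>(1), of "inv h" h] rep_one[OF \<rho>(1)] by simp
  then have "mat_trace (\<rho> h * \<rho> g * \<rho> (inv h)) = mat_trace (\<rho> g)"
    using assms rep_carrier[OF \<rho>(1)] by (intro mat_trace_conj[of _ n]) auto
  then show ?thesis using assms by (simp add: \<rho>(2) rep_mult[OF \<rho>(1)])
qed

lemma Irr_algebraic_int:
  assumes "\<chi> \<in> Irr G" "g \<in> carrier G"
  shows "algebraic_int (\<chi> g)"
  and Irr_inv: "\<chi> (inv g) = cnj (\<chi> g)"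
proof -
  obtain n \<rho> where \<rho>: "irreducible_rep G n \<rho>" "\<And>g. g \<in> carrier G \<Longrightarrow> \<chi> g = mat_trace (\<rho> g)"
    using IrrE[OF assms(1)] by metis
  have 1: "\<rho> g ^\<^sub>m Coset.order G = 1\<^sub>m n"
    using rep_pow[OF \<rho>(1) assms(2), of "Coset.order G"] pow_order_eq_1[OF assms(2)] rep_one[OF \<rho>(1)] by simp
  have "g [^] (Coset.order G - 1) \<otimes> g = \<one>"
    using pow_order_eq_1[OF assms(2)] order_pos nat_pow_Suc[of g "Coset.order G - 1"] by simp
  then have "inv g = g [^] (Coset.order G - 1)"
    using assms(2) by (intro inv_equality) auto
  then show "algebraic_int (\<chi> g)" "\<chi> (inv g) = cnj (\<chi> g)"
    using mat_trace_finite_order[OF rep_carrier[OF \<rho>(1) assms(2)] 1 order_pos]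
      \<rho>(2) assms(2) rep_pow[OF \<rho>(1)] by auto
qed

text \<open>Invariance under conjugation; values outside \<open>carrier G\<close> are irrelevant.\<close>

definition class_function :: "('a \<Rightarrow> complex) \<Rightarrow> bool" where
  "class_function f \<longleftrightarrow> (\<forall>g\<in>carrier G. \<forall>h\<in>carrier G. f (h \<otimes> g \<otimes> inv h) = f g)"

text \<open>The element \<open>\<Sum>\<^sub>g a(g) g\<close> of the group algebra is central if \<open>a\<close> is a class function, so it
  acts on an irreducible representation as a scalar, which the trace determines.\<close>

lemma class_function_scalar:
  assumes \<rho>: "irreducible_rep G n \<rho>"
    and a: "class_function a" and ij: "i < n" "j < n"
  shows "(\<Sum>g\<in>carrier G. a g * \<rho> g $$ (i, j)) =
    (if i = j then (\<Sum>g\<in>carrier G. a g * mat_trace (\<rho> g)) / of_nat n else 0)"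
proof -
  define A where "A = mat n n (\<lambda>(i, j). \<Sum>g\<in>carrier G. a g * \<rho> g $$ (i, j))"
  have "\<rho> h * A = A * \<rho> h" if h: "h \<in> carrier G" for h
  proof (rule eq_matI)
    fix i l assume "i < dim_row (A * \<rho> h)" "l < dim_col (A * \<rho> h)"
    then have i: "i < n" and l: "l < n" using h rep_dim[OF \<rho>] by (auto simp: A_def)
    have "(\<rho> h * A) $$ (i, l) = (\<Sum>p<n. \<rho> h $$ (i, p) * (\<Sum>g\<in>carrier G. a g * \<rho> g $$ (p, l)))"
      using i l h rep_dim[OF \<rho>] by (simp add: A_def scalar_prod_def lessThan_atLeast0)
    also have "\<dots> = (\<Sum>g\<in>carrier G. a g * (\<Sum>p<n. \<rho> h $$ (i, p) * \<rho> g $$ (p, l)))"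
      by (simp add: sum_distrib_left mult_ac) (rule sum.swap)
    also have "\<dots> = (\<Sum>g\<in>carrier G. a (h \<otimes> g \<otimes> inv h) * \<rho> (h \<otimes> g \<otimes> inv h \<otimes> h) $$ (i, l))"
    proof (rule sum.cong)
      fix g assume g: "g \<in> carrier G"
      have "h \<otimes> g \<otimes> inv h \<otimes> h = h \<otimes> g" using g h by (simp add: m_assoc)
      then show "a g * (\<Sum>p<n. \<rho> h $$ (i, p) * \<rho> g $$ (p, l)) =
          a (h \<otimes> g \<otimes> inv h) * \<rho> (h \<otimes> g \<otimes> inv h \<otimes> h) $$ (i, l)"
        using rep_mult_entry[OF \<rho> h g i l] a g h by (simp add: class_function_def)
    qed simp
    also have "\<dots> = (\<Sum>g\<in>carrier G. a g * \<rho> (g \<otimes> h) $$ (i, l))"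
      using sum_conjugate[OF h, of "\<lambda>g. a g * \<rho> (g \<otimes> h) $$ (i, l)"] .
    also have "\<dots> = (\<Sum>g\<in>carrier G. \<Sum>p<n. a g * \<rho> g $$ (i, p) * \<rho> h $$ (p, l))"
      using i l h by (intro sum.cong) (auto simp: rep_mult_entry[OF \<rho>] sum_distrib_left mult.assoc)
    also have "\<dots> = (A * \<rho> h) $$ (i, l)"
      using i l h rep_dim[OF \<rho>]
      by (subst sum.swap) (simp add: A_def scalar_prod_def lessThan_atLeast0 sum_distrib_right)
    finally show "(\<rho> h * A) $$ (i, l) = (A * \<rho> h) $$ (i, l)" .
  qed (use h rep_dim[OF \<rho>] in \<open>auto simp: A_def\<close>)
  then obtain c where c: "A = c \<cdot>\<^sub>m 1\<^sub>m n"
    by (elim schur_scalar[OF \<rho>, rotated 1]) (auto simp: A_def)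
  have entry: "(\<Sum>g\<in>carrier G. a g * \<rho> g $$ (i, j)) = (if i = j then c else 0)"
    if "i < n" "j < n" for i j
  proof -
    have "A $$ (i, j) = (if i = j then c else 0)" using that by (simp add: c)
    then show ?thesis using that by (simp add: A_def)
  qed
  have "of_nat n * c = (\<Sum>i<n. \<Sum>g\<in>carrier G. a g * \<rho> g $$ (i, i))"
    by (simp add: entry)
  also have "\<dots> = (\<Sum>g\<in>carrier G. a g * mat_trace (\<rho> g))"
    using rep_dim[OF \<rho>] by (subst sum.swap) (simp add: sum_distrib_left mat_trace_def)
  finally show ?thesis using entry[OF ij] rep_pos[OF \<rho>] by (auto simp: field_simps)
qed

section \<open>Conjugacy classes\<close>

lemma conj_class_subset: "x \<in> carrier G \<Longrightarrow> conj_class G x \<subseteq> carrier G"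
  by (auto simp: conj_class_def)

lemma conj_class_self: "x \<in> carrier G \<Longrightarrow> x \<in> conj_class G x"
  unfolding conj_class_def by (rule CollectI, rule exI[of _ \<one>]) simp

lemma conj_class_conj:
  assumes "x \<in> carrier G" "h \<in> carrier G"
  shows "conj_class G (h \<otimes> x \<otimes> inv h) = conj_class G x"
proof (intro equalityI subsetI)
  fix y assume "y \<in> conj_class G (h \<otimes> x \<otimes> inv h)"
  then obtain g where "g \<in> carrier G" "y = g \<otimes> (h \<otimes> x \<otimes> inv h) \<otimes> inv g"
    by (auto simp: conj_class_def)
  then show "y \<in> conj_class G x"
    unfolding conj_class_def using assms
    by (intro CollectI exI[of _ "g \<otimes> h"]) (auto simp: inv_mult_group m_assoc)
next
  fix y assume "y \<in> conj_class G x"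
  then obtain g where "g \<in> carrier G" "y = g \<otimes> x \<otimes> inv g"
    by (auto simp: conj_class_def)
  then show "y \<in> conj_class G (h \<otimes> x \<otimes> inv h)"
    unfolding conj_class_def using assms
    by (intro CollectI exI[of _ "g \<otimes> inv h"]) (auto simp: inv_mult_group m_assoc inv_cancel)
qed

lemma conj_class_eq:
  assumes "x \<in> carrier G" "y \<in> conj_class G x"
  shows "conj_class G y = conj_class G x"
  using assms conj_class_conj[OF assms(1)] by (auto simp: conj_class_def[of G x])

lemma card_conj_class_centralizer:
  assumes x: "x \<in> carrier G"
  shows "card (conj_class G x) * card (centralizer G x) = Coset.order G"
proof -
  have "Coset.order G = (\<Sum>y\<in>conj_class G x. card {g \<in> carrier G. g \<otimes> x \<otimes> inv g = y})"
  proof -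
    have "(\<Sum>y\<in>conj_class G x. \<Sum>g\<in>{g \<in> carrier G. g \<otimes> x \<otimes> inv g = y}. 1) = (\<Sum>g\<in>carrier G. 1::nat)"
      by (rule sum.group) (use fin x finite_subset[OF conj_class_subset] in \<open>auto simp: conj_class_def\<close>)
    then show ?thesis by (simp add: Coset.order_def)
  qed
  also have "\<dots> = (\<Sum>y\<in>conj_class G x. card (centralizer G x))"
  proof (rule sum.cong)
    fix y assume "y \<in> conj_class G x"
    then obtain h where h: "h \<in> carrier G" "y = h \<otimes> x \<otimes> inv h" by (auto simp: conj_class_def)
    have eq: "h \<otimes> c \<otimes> x \<otimes> inv (h \<otimes> c) = y \<longleftrightarrow> c \<otimes> x = x \<otimes> c" if "c \<in> carrier G" for c
    proof -
      have "h \<otimes> c \<otimes> x \<otimes> inv (h \<otimes> c) = y \<longleftrightarrow> h \<otimes> (c \<otimes> x \<otimes> inv c) \<otimes> inv h = h \<otimes> x \<otimes> inv h"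
        using that h x by (simp add: inv_mult_group m_assoc)
      also have "\<dots> \<longleftrightarrow> c \<otimes> x \<otimes> inv c = x" using that h x by simp
      also have "\<dots> \<longleftrightarrow> c \<otimes> x = x \<otimes> c" using that x by (metis inv_solve_right m_closed)
      finally show ?thesis .
    qed
    have "bij_betw (\<lambda>c. h \<otimes> c) (centralizer G x) {g \<in> carrier G. g \<otimes> x \<otimes> inv g = y}"
      by (rule bij_betw_byWitness[where f' = "\<lambda>g. inv h \<otimes> g"])
        (use h x in \<open>auto simp: centralizer_def eq inv_cancel simp flip: eq\<close>)
    then show "card {g \<in> carrier G. g \<otimes> x \<otimes> inv g = y} = card (centralizer G x)"
      using bij_betw_same_card by fastforce
  qed simp
  finally show ?thesis by simp
qed

lemma centralizer_inv:
  assumes "x \<in> carrier G"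
  shows "centralizer G (inv x) = centralizer G x"
proof -
  have "g \<otimes> inv x = inv x \<otimes> g \<longleftrightarrow> g \<otimes> x = x \<otimes> g" if "g \<in> carrier G" for g
    using that assms by (metis inv_closed inv_solve_left inv_solve_right m_assoc m_closed)
  then show ?thesis by (auto simp: centralizer_def)
qed

text \<open>A set of representatives of the conjugacy classes.\<close>

lemma class_representatives:
  obtains R where "R \<subseteq> carrier G"
    "\<And>f. class_function f \<Longrightarrow>
       (\<Sum>g\<in>carrier G. f g) = (\<Sum>x\<in>R. of_nat (card (conj_class G x)) * f x)"
proof -
  define r where "r K = (SOME x. x \<in> K)" for K :: "'a set"
  define Cl where "Cl = conj_class G ` carrier G"
  have r: "r K \<in> carrier G \<and> conj_class G (r K) = K" if "K \<in> Cl" for K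
  proof -
    have "K \<in> conj_class G ` carrier G" using that by (simp add: Cl_def)
    then obtain x where x: "x \<in> carrier G" "K = conj_class G x" by blast
    then have "r K \<in> K" unfolding r_def using conj_class_self by (intro someI) auto
    then show ?thesis using x conj_class_eq conj_class_subset by blast
  qed
  have inj: "inj_on r Cl" using r by (metis inj_onI)
  have "(\<Sum>g\<in>carrier G. f g) = (\<Sum>x\<in>r ` Cl. of_nat (card (conj_class G x)) * f x)"
    if f: "class_function f" for f
  proof -
    have "(\<Sum>g\<in>carrier G. f g) = (\<Sum>K\<in>Cl. \<Sum>g\<in>{g \<in> carrier G. conj_class G g = K}. f g)"
      by (rule sum.group[symmetric]) (auto simp: Cl_def fin)
    also have "\<dots> = (\<Sum>K\<in>Cl. of_nat (card K) * f (r K))"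
    proof (rule sum.cong)
      fix K assume K: "K \<in> Cl"
      have "{g \<in> carrier G. conj_class G g = K} = K"
        using r[OF K] conj_class_eq conj_class_self conj_class_subset by blast
      moreover have "f g = f (r K)" if "g \<in> K" for g
      proof -
        have "g \<in> conj_class G (r K)" using that r[OF K] by simp
        then show ?thesis using f r[OF K] by (auto simp: conj_class_def class_function_def)
      qed
      ultimately show "(\<Sum>g\<in>{g \<in> carrier G. conj_class G g = K}. f g) = of_nat (card K) * f (r K)"
        by simp
    qed simp
    also have "\<dots> = (\<Sum>x\<in>r ` Cl. of_nat (card (conj_class G x)) * f x)"
      using r by (simp add: sum.reindex[OF inj])
    finally show ?thesis .
  qed
  then show ?thesis using that[of "r ` Cl"] r by blast
qed

section \<open>Central characters\<close>

text \<open>The sum of the class of \<open>x\<close> acts as the scalar \<open>\<omega>\<^sub>\<chi>(x)\<close>.\<close>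

lemma central_char_scalar:
  assumes \<rho>: "irreducible_rep G n \<rho>" and \<chi>: "\<And>g. g \<in> carrier G \<Longrightarrow> \<chi> g = mat_trace (\<rho> g)"
    and x: "x \<in> carrier G" and ij: "i < n" "j < n"
  shows "(\<Sum>g\<in>conj_class G x. \<rho> g $$ (i, j)) = (if i = j then central_char G \<chi> x else 0)"
proof -
  let ?a = "\<lambda>g. if g \<in> conj_class G x then 1 else (0 :: complex)"
  have Irr: "(\<lambda>g\<in>carrier G. mat_trace (\<rho> g)) \<in> Irr G" using \<rho> unfolding Irr_def by blast
  have \<chi>K: "\<chi> g = \<chi> x" if "g \<in> conj_class G x" for g
    using that x Irr_conj[OF Irr] by (auto simp: conj_class_def \<chi>)
  have ind: "(\<Sum>g\<in>carrier G. ?a g * f g) = (\<Sum>g\<in>conj_class G x. f g)" for f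
    using fin conj_class_subset[OF x] by (intro sum.mono_neutral_cong_right) auto
  have "?a (h \<otimes> g \<otimes> inv h) = ?a g" if "g \<in> carrier G" "h \<in> carrier G" for g h
    using conj_class_conj[OF that] conj_class_self conj_class_eq[OF x] that by (metis inv_closed m_closed)
  then have "class_function ?a" unfolding class_function_def by blast
  then have "(\<Sum>g\<in>conj_class G x. \<rho> g $$ (i, j)) =
      (if i = j then (\<Sum>g\<in>conj_class G x. mat_trace (\<rho> g)) / of_nat n else 0)"
    using class_function_scalar[OF \<rho> _ ij, of ?a] unfolding ind by blast
  moreover have "(\<Sum>g\<in>conj_class G x. mat_trace (\<rho> g)) = of_nat (card (conj_class G x)) * \<chi> x"
    using \<chi>K \<chi> conj_class_subset[OF x] by (metis (no_types, lifting) subsetD sum.cong sum_constant)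
  moreover have "\<chi> \<one> = of_nat n"
    using \<chi>[OF one_closed] by (simp add: rep_one[OF \<rho>] mat_trace_def)
  ultimately show ?thesis by (simp add: central_char_def)
qed

text \<open>Multiplication by the class sum is an integral matrix on the group algebra, and a matrix
  coefficient \<open>g \<mapsto> \<rho>(g)\<^sub>0\<^sub>0\<close> is an eigenvector of it with eigenvalue \<open>\<omega>\<^sub>\<chi>(x)\<close>.\<close>

theorem central_char_algebraic_int:
  assumes "\<chi> \<in> Irr G" and x: "x \<in> carrier G"
  shows "algebraic_int (central_char G \<chi> x)"
proof -
  obtain n \<rho> where \<rho>: "irreducible_rep G n \<rho>" "\<And>g. g \<in> carrier G \<Longrightarrow> \<chi> g = mat_trace (\<rho> g)" "0 < n"
    using IrrE[OF assms(1)] by metis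
  let ?w = "\<lambda>g. \<rho> g $$ (0, 0)" and ?K = "conj_class G x" and ?N = "card (carrier G)"
  have step: "central_char G \<chi> x * ?w g = (\<Sum>h\<in>carrier G. if h \<otimes> inv g \<in> ?K then ?w h else 0)"
    if g: "g \<in> carrier G" for g
  proof -
    have "central_char G \<chi> x * ?w g =
        (\<Sum>p<n. if p = 0 then central_char G \<chi> x * \<rho> g $$ (p, 0) else 0)"
      using \<rho>(3) by simp
    also have "\<dots> = (\<Sum>p<n. (\<Sum>h\<in>?K. \<rho> h $$ (0, p)) * \<rho> g $$ (p, 0))"
      using central_char_scalar[OF \<rho>(1,2) x \<rho>(3)] by (intro sum.cong) auto
    also have "\<dots> = (\<Sum>h\<in>?K. \<Sum>p<n. \<rho> h $$ (0, p) * \<rho> g $$ (p, 0))"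
      by (simp add: sum_distrib_right) (rule sum.swap)
    also have "\<dots> = (\<Sum>h\<in>?K. ?w (h \<otimes> g))"
      using g conj_class_subset[OF x] \<rho>(3)
      by (intro sum.cong) (auto simp: rep_mult_entry[OF \<rho>(1)])
    also have "\<dots> = (\<Sum>h\<in>{h \<in> carrier G. h \<otimes> inv g \<in> ?K}. ?w h)"
      by (rule sum.reindex_bij_witness[of _ "\<lambda>h. h \<otimes> inv g" "\<lambda>h. h \<otimes> g"])
        (use g conj_class_subset[OF x] in \<open>auto simp: m_assoc subset_iff\<close>)
    also have "\<dots> = (\<Sum>h\<in>carrier G. if h \<otimes> inv g \<in> ?K then ?w h else 0)"
      using fin by (simp add: sum.inter_filter)
    finally show ?thesis .
  qed
  obtain e where e: "bij_betw e {..<?N} (carrier G)"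
    using ex_bij_betw_nat_finite[OF fin] by (auto simp: lessThan_atLeast0)
  obtain k where k: "k < ?N" "e k = \<one>"
    using e one_closed unfolding bij_betw_def by (metis imageE lessThan_iff)
  show ?thesis
  proof (rule algebraic_int_eigen[of k ?N "\<lambda>i. ?w (e i)"])
    show "?w (e k) \<noteq> 0" using k rep_one[OF \<rho>(1)] \<rho>(3) by simp
    fix i assume "i < ?N"
    then have ei: "e i \<in> carrier G" using e by (auto simp: bij_betw_def)
    have "central_char G \<chi> x * ?w (e i) =
        (\<Sum>l<?N. if e l \<otimes> inv (e i) \<in> ?K then ?w (e l) else 0)"
      unfolding step[OF ei] by (rule sum.reindex_bij_betw[OF e, symmetric])
    also have "\<dots> = (\<Sum>l<?N. of_int (if e l \<otimes> inv (e i) \<in> ?K then 1 else 0) * ?w (e l))"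
      by (intro sum.cong) auto
    finally show "\<exists>a::nat \<Rightarrow> int. central_char G \<chi> x * ?w (e i) = (\<Sum>l<?N. of_int (a l) * ?w (e l))"
      by (rule exI[of _ "\<lambda>l. if e l \<otimes> inv (e i) \<in> ?K then 1 else 0"])
  qed (use k in simp)
qed

lemma central_char_class:
  assumes "\<chi> \<in> Irr G" and "x \<in> carrier G"
  shows "of_nat (card (conj_class G x)) * \<chi> x = \<chi> \<one> * central_char G \<chi> x"
    and "of_nat (card (centralizer G x)) * central_char G \<chi> x = of_nat (Coset.order G) / \<chi> \<one> * \<chi> x"
proof -
  obtain n where "0 < n" "\<chi> \<one> = of_nat n" using Irr_degree[OF assms(1)] by metis
  then show "of_nat (card (conj_class G x)) * \<chi> x = \<chi> \<one> * central_char G \<chi> x"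
    by (simp add: central_char_def)
  show "of_nat (card (centralizer G x)) * central_char G \<chi> x = of_nat (Coset.order G) / \<chi> \<one> * \<chi> x"
    using card_conj_class_centralizer[OF assms(2), symmetric] by (simp add: central_char_def mult_ac)
qed

text \<open>The quotient is rational, and an algebraic integer because
  \<open>\<bar>G\<bar> / \<chi>(\<one>) = \<Sum>\<^sub>x \<omega>\<^sub>\<chi>(x) \<chi>(x\<inverse>)\<close>, where \<open>x\<close> runs over representatives of the classes.\<close>

theorem degree_dvd_order:
  assumes \<chi>: "\<chi> \<in> Irr G"
  obtains q where "0 < q" "of_nat (Coset.order G) / \<chi> \<one> = of_nat q"
proof -
  obtain n where n: "0 < n" "\<chi> \<one> = of_nat n" using Irr_degree[OF assms(1)] by metis
  obtain R where R: "R \<subseteq> carrier G" and sum: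
    "\<And>f. class_function f \<Longrightarrow>
       (\<Sum>g\<in>carrier G. f g) = (\<Sum>x\<in>R. of_nat (card (conj_class G x)) * f x)"
    using class_representatives by blast
  let ?z = "of_nat (Coset.order G) / \<chi> \<one>"
  have "of_nat (Coset.order G) = (\<Sum>g\<in>carrier G. \<chi> g * cnj (\<chi> g))"
    using Irr_norm[OF \<chi>] by (simp add: Irr_inv[OF \<chi>])
  also have "\<dots> = (\<Sum>x\<in>R. of_nat (card (conj_class G x)) * (\<chi> x * cnj (\<chi> x)))"
    by (rule sum) (simp add: class_function_def Irr_conj[OF \<chi>])
  also have "\<dots> = \<chi> \<one> * (\<Sum>x\<in>R. central_char G \<chi> x * cnj (\<chi> x))"
    using R central_char_class(1)[OF \<chi>]
    by (auto simp: sum_distrib_left mult.assoc[symmetric] intro!: sum.cong)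
  finally have z: "?z = (\<Sum>x\<in>R. central_char G \<chi> x * cnj (\<chi> x))" using n by simp
  have "algebraic_int ?z"
    unfolding z using R central_char_algebraic_int[OF \<chi>] Irr_algebraic_int[OF \<chi>]
    by (intro algebraic_int_sum) (auto simp: algebraic_int_add_mult subset_iff)
  moreover have "?z \<in> \<rat>" using n by simp
  ultimately have "?z \<in> \<int>" by (rule rational_algebraic_int_is_int)
  then obtain k :: int where k: "?z = of_int k" by (auto elim: Ints_cases)
  then have "complex_of_real (real (Coset.order G) / real n) = complex_of_real (real_of_int k)"
    using n by simp
  then have "real (Coset.order G) / real n = real_of_int k" by (simp only: of_real_eq_iff)
  moreover have "real (Coset.order G) / real n > 0" using order_pos n by simp
  ultimately have "k > 0" by simp
  then show ?thesis using that[of "nat k"] k by simp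
qed

end

section \<open>Reduction modulo a maximal ideal over 2\<close>

locale maxideal_over_2 =
  fixes M :: "complex set"
  assumes maxideal: "maxideal_over 2 M"
begin

lemma M_0: "0 \<in> M"
  and M_2: "2 \<in> M"
  and M_add: "a \<in> M \<Longrightarrow> b \<in> M \<Longrightarrow> a + b \<in> M"
  and M_mult: "a \<in> M \<Longrightarrow> algebraic_int r \<Longrightarrow> r * a \<in> M"
  and M_prime: "algebraic_int a \<Longrightarrow> algebraic_int b \<Longrightarrow> a * b \<in> M \<Longrightarrow> a \<in> M \<or> b \<in> M"
  and M_1: "1 \<notin> M"
proof -
  have max: "maximalideal M alg_ints" and 2: "of_nat 2 \<in> M"
    using maxideal by (auto simp: maxideal_over_def)
  interpret maximalideal M alg_ints by (rule max)
  interpret cring alg_ints by (rule cring_alg_ints)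
  interpret primeideal M alg_ints by (rule maximalideal_prime[OF max])
  note id = is_ideal[unfolded ideal_alg_ints_iff]
  show "2 \<in> M" using 2 by simp
  show "0 \<in> M" using id by blast
  show "a \<in> M \<Longrightarrow> b \<in> M \<Longrightarrow> a + b \<in> M" for a b using id by blast
  show "a \<in> M \<Longrightarrow> algebraic_int r \<Longrightarrow> r * a \<in> M" for a r using id by blast
  show "algebraic_int a \<Longrightarrow> algebraic_int b \<Longrightarrow> a * b \<in> M \<Longrightarrow> a \<in> M \<or> b \<in> M" for a b
    using I_prime[of a b] by (simp add: alg_ints_def)
  show "1 \<notin> M" using one_imp_carrier I_notcarr by (auto simp: alg_ints_def)
qed

lemma M_mult_right: "a \<in> M \<Longrightarrow> algebraic_int r \<Longrightarrow> a * r \<in> M"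
  using M_mult by (simp add: mult.commute)

lemma M_sum: "(\<And>x. x \<in> I \<Longrightarrow> f x \<in> M) \<Longrightarrow> sum f I \<in> M"
  by (induction I rule: infinite_finite_induct) (auto intro: M_0 M_add)

lemma M_of_nat: "of_nat k \<in> M \<longleftrightarrow> even k"
proof
  have *: "of_nat k \<in> M" if "even k" for k
  proof -
    from that obtain l where "k = 2 * l" by (rule evenE)
    then show ?thesis using M_mult[OF M_2, of "of_nat l"] by (simp add: mult.commute)
  qed
  then show "even k \<Longrightarrow> of_nat k \<in> M" .
  assume k: "of_nat k \<in> M"
  show "even k"
  proof (rule ccontr)
    assume "odd k"
    then obtain l where l: "k = 2 * l + 1" by (rule oddE)
    have "- of_nat (2 * l) \<in> M" using M_mult[OF *[of "2 * l"], of "- 1"] by simp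
    then have "of_nat k + - of_nat (2 * l) \<in> M" by (rule M_add[OF k])
    then show False using M_1 by (simp add: l)
  qed
qed

text \<open>The elements \<open>r / s\<close> with \<open>s \<notin> M\<close>: the carrier of the localization.\<close>

definition loc_int :: "complex \<Rightarrow> bool" where
  "loc_int z \<longleftrightarrow> (\<exists>r s. algebraic_int r \<and> algebraic_int s \<and> s \<notin> M \<and> z = r / s)"

lemma loc_ideal_iff: "z \<in> loc_ideal M \<longleftrightarrow> (\<exists>r s. r \<in> M \<and> algebraic_int s \<and> s \<notin> M \<and> z = r / s)"
  by (auto simp: loc_ideal_def alg_ints_def)

lemma loc_idealI:
  assumes "r \<in> M" "algebraic_int s" "s \<notin> M"
  shows "r / s \<in> loc_ideal M"
  using assms unfolding loc_ideal_iff by blast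

lemma loc_intI:
  assumes "algebraic_int r" "algebraic_int s" "s \<notin> M"
  shows "loc_int (r / s)"
  using assms unfolding loc_int_def by blast

lemma algebraic_loc_int: "algebraic_int z \<Longrightarrow> loc_int z"
  using loc_intI[of z 1] M_1 by simp

lemma nonzero: "s \<notin> M \<Longrightarrow> s \<noteq> 0"
  using M_0 by auto

lemma not_M_mult: "algebraic_int s \<Longrightarrow> algebraic_int t \<Longrightarrow> s \<notin> M \<Longrightarrow> t \<notin> M \<Longrightarrow> s * t \<notin> M"
  using M_prime by blast

lemma loc_ideal_mult:
  assumes "loc_int a" "b \<in> loc_ideal M"
  shows "a * b \<in> loc_ideal M" "b * a \<in> loc_ideal M"
proof -
  obtain r s where a: "algebraic_int r" "algebraic_int s" "s \<notin> M" "a = r / s"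
    using assms(1) unfolding loc_int_def by blast
  obtain r' s' where b: "r' \<in> M" "algebraic_int s'" "s' \<notin> M" "b = r' / s'"
    using assms(2) unfolding loc_ideal_iff by blast
  have "a * b = (r * r') / (s * s')" using a b by simp
  then show "a * b \<in> loc_ideal M"
    using a b by (simp only:) (intro loc_idealI M_mult not_M_mult; simp add: algebraic_int_add_mult)
  then show "b * a \<in> loc_ideal M" by (simp add: mult.commute)
qed

lemma loc_ideal_0: "0 \<in> loc_ideal M"
  unfolding loc_ideal_iff using M_0 M_1 by (intro exI[of _ 0] exI[of _ 1]) auto

lemma loc_ideal_add:
  assumes "a \<in> loc_ideal M" "b \<in> loc_ideal M"
  shows "a + b \<in> loc_ideal M"
proof -
  obtain r s where a: "r \<in> M" "algebraic_int s" "s \<notin> M" "a = r / s"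
    using assms(1) unfolding loc_ideal_iff by blast
  obtain r' s' where b: "r' \<in> M" "algebraic_int s'" "s' \<notin> M" "b = r' / s'"
    using assms(2) unfolding loc_ideal_iff by blast
  have "a + b = (s' * r + s * r') / (s * s')"
    using a b nonzero by (simp add: add_frac_eq mult.commute)
  then show ?thesis
    using a b by (simp only:) (intro loc_idealI M_add M_mult not_M_mult; simp add: algebraic_int_add_mult)
qed

lemma loc_ideal_uminus: "a \<in> loc_ideal M \<Longrightarrow> - a \<in> loc_ideal M"
  using loc_ideal_mult(1)[OF algebraic_loc_int, of "- 1" a] by simp

lemma loc_ideal_sum: "(\<And>x. x \<in> I \<Longrightarrow> f x \<in> loc_ideal M) \<Longrightarrow> sum f I \<in> loc_ideal M"
  by (induction I rule: infinite_finite_induct) (auto intro: loc_ideal_0 loc_ideal_add)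

lemma loc_ideal_1: "1 \<notin> loc_ideal M"
proof
  assume "1 \<in> loc_ideal M"
  then obtain r s where "r \<in> M" "s \<notin> M" "1 = r / s" unfolding loc_ideal_iff by blast
  then show False by (cases "s = 0") auto
qed

lemma red_altdef: "red M z = {l + z | l. l \<in> loc_ideal M}"
  by (auto simp: red_def a_r_coset_def r_coset_def loc_ring_def)

lemma red_eq_iff: "red M a = red M b \<longleftrightarrow> a - b \<in> loc_ideal M"
proof
  assume "red M a = red M b"
  moreover have "a \<in> red M a" using loc_ideal_0 by (auto simp: red_altdef)
  ultimately show "a - b \<in> loc_ideal M" by (auto simp: red_altdef)
next
  have *: "red M a \<subseteq> red M b" if "a - b \<in> loc_ideal M" for a b
  proof
    fix y assume "y \<in> red M a"
    then obtain l where "l \<in> loc_ideal M" "y = l + a" by (auto simp: red_altdef)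
    then have "y = (l + (a - b)) + b" "l + (a - b) \<in> loc_ideal M"
      using loc_ideal_add that by auto
    then show "y \<in> red M b" unfolding red_altdef by blast
  qed
  assume "a - b \<in> loc_ideal M"
  then show "red M a = red M b"
    using *[of a b] *[of b a] loc_ideal_uminus[of "a - b"] by auto
qed

lemma red_eq_zero_iff: "red M z = \<zero>\<^bsub>residue_field M\<^esub> \<longleftrightarrow> z \<in> loc_ideal M"
proof -
  have "\<zero>\<^bsub>residue_field M\<^esub> = red M 0"
    by (simp add: residue_field_def FactRing_def red_altdef)
  then show ?thesis using red_eq_iff[of z 0] by simp
qed

end

section \<open>Characters that vanish on all involutions\<close>

lemma even_card_fixpoint_free:
  assumes "finite A" "\<And>x. x \<in> A \<Longrightarrow> f x \<in> A \<and> f (f x) = x \<and> f x \<noteq> x"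
  shows "even (card A)"
  using assms
proof (induction "card A" arbitrary: A rule: less_induct)
  case less
  show ?case
  proof (cases "A = {}")
    case False
    then obtain x where x: "x \<in> A" by blast
    let ?B = "A - {x, f x}"
    have sub: "{x, f x} \<subseteq> A" and two: "card {x, f x} = 2" using less.prems(2)[OF x] x by auto
    then have card: "card A = card ?B + 2"
      using less.prems(1) card_mono[OF less.prems(1) sub] by (simp add: card_Diff_subset)
    have "even (card ?B)"
    proof (rule less.hyps)
      show "card ?B < card A" using card by simp
      show "f y \<in> ?B \<and> f (f y) = y \<and> f y \<noteq> y" if "y \<in> ?B" for y
        using that less.prems(2)[of y] less.prems(2)[OF x] by auto
    qed (use less.prems(1) in simp)
    then show ?thesis using card by simp
  qed simp
qed

lemma even_card_involution:
  assumes "finite A" "\<And>x. x \<in> A \<Longrightarrow> f x \<in> A \<and> f (f x) = x"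
  shows "even (card A) \<longleftrightarrow> even (card {x \<in> A. f x = x})"
proof -
  have "card A = card {x \<in> A. f x = x} + card {x \<in> A. f x \<noteq> x}"
    using assms(1) by (subst card_Un_disjoint[symmetric]) (auto intro: arg_cong[where f = card])
  moreover have "even (card {x \<in> A. f x \<noteq> x})"
    by (rule even_card_fixpoint_free[where f = f]) (use assms in auto)
  ultimately show ?thesis by simp
qed

context fin_group
begin


lemma involution_iff: "involution G t \<longleftrightarrow> t \<in> carrier G \<and> t \<noteq> \<one> \<and> t \<otimes> t = \<one>"
proof (cases "t \<in> carrier G")
  case True
  have "ord t = 2 \<longleftrightarrow> t \<noteq> \<one> \<and> t \<otimes> t = \<one>"
  proof
    assume "ord t = 2"
    then show "t \<noteq> \<one> \<and> t \<otimes> t = \<one>"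
      using pow_ord_eq_1[OF True] True by (auto simp: numeral_2_eq_2)
  next
    assume t: "t \<noteq> \<one> \<and> t \<otimes> t = \<one>"
    then have "t [^] (2::nat) = \<one>" using True by (simp add: numeral_2_eq_2)
    then have "ord t dvd 2" using pow_eq_id[OF True, of 2] by simp
    then have "ord t = 1 \<or> ord t = 2" using prime_nat_iff two_is_prime_nat by blast
    then show "ord t = 2" using t ord_eq_1[OF True] by auto
  qed
  then show ?thesis using True by (simp add: involution_def)
qed (simp add: involution_def)

text \<open>The involutions and the identity.\<close>

definition square_roots :: "'a set" where
  "square_roots = {s \<in> carrier G. s \<otimes> s = \<one>}"

text \<open>The coefficient at \<open>g\<close> of the square of the sum of \<open>square_roots\<close> in the group algebra: if
  \<open>s\<^sup>2 = \<one>\<close>, then \<open>g = s t\<close> means \<open>t = s g\<close>.\<close>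

definition sq_coeff :: "'a \<Rightarrow> nat" where
  "sq_coeff g = card {s \<in> square_roots. s \<otimes> g \<in> square_roots}"

lemma square_roots_conj:
  assumes "s \<in> carrier G" "h \<in> carrier G"
  shows "h \<otimes> s \<otimes> inv h \<in> square_roots \<longleftrightarrow> s \<in> square_roots"
proof -
  have "(h \<otimes> s \<otimes> inv h) \<otimes> (h \<otimes> s \<otimes> inv h) = h \<otimes> (s \<otimes> s) \<otimes> inv h"
    using assms by (simp add: m_assoc inv_cancel)
  moreover have "h \<otimes> (s \<otimes> s) \<otimes> inv h = \<one> \<longleftrightarrow> s \<otimes> s = \<one>"
    using assms by (metis inv_closed inv_comm inv_inv inv_solve_right l_cancel_one m_closed one_closed r_inv r_one right_cancel)
  ultimately show ?thesis using assms by (simp add: square_roots_def)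
qed

lemma sq_coeff_conj:
  assumes "g \<in> carrier G" "h \<in> carrier G"
  shows "sq_coeff (h \<otimes> g \<otimes> inv h) = sq_coeff g"
proof -
  have "bij_betw (\<lambda>s. h \<otimes> s \<otimes> inv h) {s \<in> square_roots. s \<otimes> g \<in> square_roots}
      {s \<in> square_roots. s \<otimes> (h \<otimes> g \<otimes> inv h) \<in> square_roots}"
  proof (rule bij_betw_byWitness[where f' = "\<lambda>s. inv h \<otimes> s \<otimes> h"])
    have 1: "h \<otimes> s \<otimes> inv h \<otimes> (h \<otimes> g \<otimes> inv h) = h \<otimes> (s \<otimes> g) \<otimes> inv h" if "s \<in> carrier G" for s
      using that assms by (simp add: m_assoc inv_cancel)
    show "(\<lambda>s. h \<otimes> s \<otimes> inv h) ` {s \<in> square_roots. s \<otimes> g \<in> square_roots}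
        \<subseteq> {s \<in> square_roots. s \<otimes> (h \<otimes> g \<otimes> inv h) \<in> square_roots}"
      using assms 1 square_roots_conj by (auto simp: square_roots_def)
    have 2: "inv h \<otimes> s \<otimes> h \<otimes> g = inv h \<otimes> (s \<otimes> (h \<otimes> g \<otimes> inv h)) \<otimes> h" if "s \<in> carrier G" for s
      using that assms by (simp add: m_assoc)
    have 3: "inv h \<otimes> s \<otimes> h \<in> square_roots \<longleftrightarrow> s \<in> square_roots" if "s \<in> carrier G" for s
      using square_roots_conj[of s "inv h"] that assms by simp
    show "(\<lambda>s. inv h \<otimes> s \<otimes> h) ` {s \<in> square_roots. s \<otimes> (h \<otimes> g \<otimes> inv h) \<in> square_roots}
        \<subseteq> {s \<in> square_roots. s \<otimes> g \<in> square_roots}"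
      using assms 2 3 by (auto simp: square_roots_def)
  qed (use assms in \<open>auto simp: square_roots_def m_assoc inv_cancel\<close>)
  then show ?thesis unfolding sq_coeff_def by (rule bij_betw_same_card[symmetric])
qed

text \<open>The elements that invert \<open>g\<close> form a coset \<open>J\<close> of the centralizer, or there are none.  The
  coset is closed under inversion, and \<open>sq_coeff g\<close> counts the fixed points of inversion on it.\<close>

lemma sq_coeff_even:
  assumes g: "g \<in> carrier G" and even: "even (card (centralizer G g))"
  shows "even (sq_coeff g)"
proof -
  define J where "J = {s \<in> carrier G. s \<otimes> g = inv g \<otimes> s}"
  have J_carrier: "s \<in> carrier G" if "s \<in> J" for s using that by (simp add: J_def)
  have inv_J: "inv s \<in> J" if "s \<in> J" for s
    using that g unfolding J_def
    by (smt (verit, ccfv_threshold) inv_closed inv_solve_left inv_solve_right m_assoc m_closed mem_Collect_eq)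
  have "{s \<in> square_roots. s \<otimes> g \<in> square_roots} = {s \<in> J. inv s = s}"
  proof -
    have "s \<otimes> s = \<one> \<longleftrightarrow> inv s = s" if "s \<in> carrier G" for s
      using that by (metis inv_equality l_inv)
    moreover have "(s \<otimes> g) \<otimes> (s \<otimes> g) = \<one> \<longleftrightarrow> s \<otimes> g = inv g \<otimes> s"
      if "s \<in> carrier G" "inv s = s" for s
    proof -
      have "(s \<otimes> g) \<otimes> (s \<otimes> g) = \<one> \<longleftrightarrow> s \<otimes> g = inv (s \<otimes> g)"
        using that g by (metis inv_equality l_inv m_closed)
      then show ?thesis using that g by (simp add: inv_mult_group)
    qed
    ultimately show ?thesis using g by (auto simp: square_roots_def J_def)
  qed
  moreover have "even (card {s \<in> J. inv s = s}) \<longleftrightarrow> even (card J)"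
    by (rule even_card_involution[symmetric]) (use fin inv_J in \<open>auto simp: J_def\<close>)
  moreover have "even (card J)"
  proof (cases "J = {}")
    case False
    then obtain s where s: "s \<in> J" by blast
    have sg: "s \<otimes> g = inv g \<otimes> s" "s \<in> carrier G" using s by (auto simp: J_def)
    have eq: "s \<otimes> c \<in> J \<longleftrightarrow> c \<in> centralizer G g" if c: "c \<in> carrier G" for c
    proof -
      have "inv g \<otimes> (s \<otimes> c) = s \<otimes> (g \<otimes> c)"
        using c g sg by (metis inv_closed m_assoc)
      moreover have "s \<otimes> c \<otimes> g = s \<otimes> (c \<otimes> g)" using c g sg by (simp add: m_assoc)
      ultimately show ?thesis
        using c g sg by (simp add: J_def centralizer_def)
    qed
    have "bij_betw (\<lambda>c. s \<otimes> c) (centralizer G g) J"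
    proof (rule bij_betw_byWitness[where f' = "\<lambda>c. inv s \<otimes> c"])
      show "(\<lambda>c. s \<otimes> c) ` centralizer G g \<subseteq> J" using eq by (auto simp: centralizer_def)
      show "(\<lambda>c. inv s \<otimes> c) ` J \<subseteq> centralizer G g"
      proof (intro image_subsetI)
        fix c assume "c \<in> J"
        then show "inv s \<otimes> c \<in> centralizer G g"
          using eq[of "inv s \<otimes> c"] sg J_carrier by (simp add: inv_cancel)
      qed
    qed (use sg J_carrier in \<open>auto simp: centralizer_def inv_cancel\<close>)
    then show ?thesis using even bij_betw_same_card by metis
  qed simp
  ultimately show ?thesis by (simp add: sq_coeff_def)
qed

lemma sq_coeff_sum:
  assumes \<chi>: "\<chi> \<in> Irr G" and van: "\<And>t. involution G t \<Longrightarrow> \<chi> t = 0"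
  shows "(\<Sum>g\<in>carrier G. of_nat (sq_coeff g) * \<chi> g) = \<chi> \<one>"
proof -
  obtain n \<rho> where \<rho>: "irreducible_rep G n \<rho>" "\<And>g. g \<in> carrier G \<Longrightarrow> \<chi> g = mat_trace (\<rho> g)"
    "\<And>g. g \<in> carrier G \<Longrightarrow> \<chi> g = (\<Sum>i<n. \<rho> g $$ (i, i))" "\<chi> \<one> = of_nat n" "0 < n"
    by (rule IrrE[OF \<chi>]) (rule that)
  let ?I = "square_roots"
  have I: "s \<in> carrier G" "s \<otimes> s = \<one>" if "s \<in> ?I" for s using that by (auto simp: square_roots_def)
  have finI: "finite ?I" using fin by (simp add: square_roots_def)
  let ?a = "\<lambda>g. if g \<in> ?I then 1 else (0 :: complex)"
  have ind: "(\<Sum>g\<in>carrier G. ?a g * f g) = (\<Sum>g\<in>?I. f g)" for f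
    using fin I by (intro sum.mono_neutral_cong_right) auto
  have "(\<Sum>g\<in>?I. mat_trace (\<rho> g)) = (\<Sum>g\<in>?I. if g = \<one> then of_nat n else 0)"
  proof (rule sum.cong)
    fix g assume g: "g \<in> ?I"
    then show "mat_trace (\<rho> g) = (if g = \<one> then of_nat n else 0)"
      using I[OF g] van[of g] \<rho>(2)[of g] \<rho>(4) by (auto simp: involution_iff)
  qed simp
  also have "\<dots> = of_nat n" using finI by (simp add: square_roots_def)
  finally have tr: "(\<Sum>g\<in>?I. mat_trace (\<rho> g)) = of_nat n" .
  have scalar: "(\<Sum>s\<in>?I. \<rho> s $$ (i, j)) = (if i = j then 1 else 0)" if "i < n" "j < n" for i j
  proof -
    have "?a (h \<otimes> g \<otimes> inv h) = ?a g" if "g \<in> carrier G" "h \<in> carrier G" for g h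
      using square_roots_conj[OF that] by simp
    then have "class_function ?a" unfolding class_function_def by blast
    then show ?thesis
      using class_function_scalar[OF \<rho>(1) _ that, of ?a] \<rho>(5) unfolding ind tr by simp
  qed
  have "(\<Sum>s\<in>?I. \<Sum>t\<in>?I. \<chi> (s \<otimes> t)) =
      (\<Sum>s\<in>?I. \<Sum>t\<in>?I. \<Sum>i<n. \<Sum>k<n. \<rho> s $$ (i, k) * \<rho> t $$ (k, i))"
    using I by (intro sum.cong) (auto simp: \<rho>(3) rep_mult_entry[OF \<rho>(1)])
  also have "\<dots> = (\<Sum>s\<in>?I. \<Sum>i<n. \<Sum>k<n. \<Sum>t\<in>?I. \<rho> s $$ (i, k) * \<rho> t $$ (k, i))"
    by (intro sum.cong refl) (subst sum.swap, intro sum.cong refl sum.swap)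
  also have "\<dots> = (\<Sum>i<n. \<Sum>k<n. \<Sum>s\<in>?I. \<Sum>t\<in>?I. \<rho> s $$ (i, k) * \<rho> t $$ (k, i))"
    by (subst sum.swap, intro sum.cong refl sum.swap)
  also have "\<dots> = (\<Sum>i<n. \<Sum>k<n. if i = k then 1 else 0)"
    by (intro sum.cong refl) (auto simp: sum_product[symmetric] scalar)
  also have "\<dots> = of_nat n" by simp
  finally have "(\<Sum>s\<in>?I. \<Sum>t\<in>?I. \<chi> (s \<otimes> t)) = \<chi> \<one>" using \<rho>(4) by simp
  moreover have "(\<Sum>t\<in>?I. \<chi> (s \<otimes> t)) = (\<Sum>g\<in>carrier G. if s \<otimes> g \<in> ?I then \<chi> g else 0)"
    if s: "s \<in> ?I" for s
  proof -
    have "(\<Sum>t\<in>?I. \<chi> (s \<otimes> t)) = (\<Sum>g\<in>{g \<in> carrier G. s \<otimes> g \<in> ?I}. \<chi> g)"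
    proof (rule sum.reindex_bij_witness[of _ "\<lambda>g. s \<otimes> g" "\<lambda>g. s \<otimes> g"])
      have "s \<otimes> (s \<otimes> g) = g" if "g \<in> carrier G" for g
        using that I[OF s] by (simp add: m_assoc[symmetric])
      then show "s \<otimes> (s \<otimes> a) = a" "s \<otimes> a \<in> {g \<in> carrier G. s \<otimes> g \<in> ?I}" if "a \<in> ?I" for a
        using that I s by auto
      then show "s \<otimes> (s \<otimes> b) = b" "s \<otimes> b \<in> ?I" if "b \<in> {g \<in> carrier G. s \<otimes> g \<in> ?I}" for b
        using that \<open>\<And>g. g \<in> carrier G \<Longrightarrow> s \<otimes> (s \<otimes> g) = g\<close> by auto
    qed simp
    then show ?thesis using fin by (simp add: sum.inter_filter)
  qed
  ultimately have "\<chi> \<one> = (\<Sum>s\<in>?I. \<Sum>g\<in>carrier G. if s \<otimes> g \<in> ?I then \<chi> g else 0)" by simp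
  also have "\<dots> = (\<Sum>g\<in>carrier G. \<Sum>s\<in>?I. if s \<otimes> g \<in> ?I then \<chi> g else 0)" by (rule sum.swap)
  also have "\<dots> = (\<Sum>g\<in>carrier G. of_nat (sq_coeff g) * \<chi> g)"
    using finI by (simp add: sum.inter_filter[symmetric] sq_coeff_def)
  finally show ?thesis by simp
qed

end

text \<open>A finite group together with a maximal ideal over 2.\<close>

locale fin_group_mod_2 = fin_group G + maxideal_over_2 M
  for G (structure) and M
begin

lemma vanishing_imp_defect_zero:
  assumes \<chi>: "\<chi> \<in> Irr G" and van: "\<And>t. involution G t \<Longrightarrow> \<chi> t = 0"
    and q: "of_nat (Coset.order G) / \<chi> \<one> = of_nat q"
  shows "odd q"
proof
  assume "even q"
  obtain n where n: "0 < n" "\<chi> \<one> = of_nat n" by (rule Irr_degree[OF \<chi>])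
  obtain R where R: "R \<subseteq> carrier G" and sum:
    "\<And>f. class_function f \<Longrightarrow>
       (\<Sum>g\<in>carrier G. f g) = (\<Sum>x\<in>R. of_nat (card (conj_class G x)) * f x)"
    using class_representatives by blast
  have "\<chi> \<one> = (\<Sum>x\<in>R. of_nat (card (conj_class G x)) * (of_nat (sq_coeff x) * \<chi> x))"
  proof -
    have "(\<Sum>g\<in>carrier G. of_nat (sq_coeff g) * \<chi> g) = \<chi> \<one>"
      using sq_coeff_sum[OF \<chi>] van by blast
    moreover have "class_function (\<lambda>g. of_nat (sq_coeff g) * \<chi> g)"
      by (simp add: class_function_def Irr_conj[OF \<chi>] sq_coeff_conj)
    ultimately show ?thesis using sum by simp
  qed
  also have "\<dots> = \<chi> \<one> * (\<Sum>x\<in>R. of_nat (sq_coeff x) * central_char G \<chi> x)"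
    unfolding sum_distrib_left
  proof (rule sum.cong)
    fix x assume "x \<in> R"
    then have "of_nat (card (conj_class G x)) * \<chi> x = \<chi> \<one> * central_char G \<chi> x"
      using R central_char_class(1)[OF \<chi>] by blast
    then show "of_nat (card (conj_class G x)) * (of_nat (sq_coeff x) * \<chi> x) =
        \<chi> \<one> * (of_nat (sq_coeff x) * central_char G \<chi> x)"
      by (metis mult.left_commute)
  qed simp
  finally have one: "(\<Sum>x\<in>R. of_nat (sq_coeff x) * central_char G \<chi> x) = 1" using n by simp
  have "of_nat (sq_coeff x) * central_char G \<chi> x \<in> M" if "x \<in> R" for x
  proof -
    have x: "x \<in> carrier G" using that R by blast
    note alg = central_char_algebraic_int[OF \<chi> x]
    show ?thesis
    proof (cases "even (card (centralizer G x))")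
      case True
      then have "of_nat (sq_coeff x) \<in> M" using sq_coeff_even[OF x] by (simp add: M_of_nat)
      then show ?thesis by (rule M_mult_right[OF _ alg])
    next
      case False
      \<comment> \<open>Here \<open>\<bar>C(x)\<bar> \<omega>\<^sub>\<chi>(x) = q \<chi>(x)\<close> lies in \<open>M\<close>, but \<open>\<bar>C(x)\<bar>\<close> does not.\<close>
      have "of_nat q \<in> M" using \<open>even q\<close> by (simp add: M_of_nat)
      then have "of_nat q * \<chi> x \<in> M"
        by (rule M_mult_right[OF _ Irr_algebraic_int(1)[OF \<chi> x]])
      then have "of_nat (card (centralizer G x)) * central_char G \<chi> x \<in> M"
        unfolding central_char_class(2)[OF \<chi> x] q .
      moreover have "of_nat (card (centralizer G x)) \<notin> M" using False by (simp add: M_of_nat)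
      ultimately have "central_char G \<chi> x \<in> M" using M_prime[OF _ alg] by blast
      then show ?thesis by (intro M_mult) auto
    qed
  qed
  then have "(\<Sum>x\<in>R. of_nat (sq_coeff x) * central_char G \<chi> x) \<in> M" by (rule M_sum)
  then show False using M_1 one by simp
qed

text \<open>The numbers \<open>e x\<close> in the proof are the coefficients of the central idempotent of \<open>\<chi>\<close>.  Since
  \<open>\<bar>G\<bar> / \<chi>(\<one>)\<close> is odd, they lie in the localization.\<close>

lemma defect_zero_block:
  assumes \<chi>: "\<chi> \<in> Irr G" and q: "of_nat (Coset.order G) / \<chi> \<one> = of_nat q" "odd q"
    and B: "B \<in> blocks G M" "\<chi> \<in> B"
  shows "\<not> positive_defect 2 G M B"
proof -
  obtain n where n: "0 < n" "\<chi> \<one> = of_nat n" by (rule Irr_degree[OF \<chi>])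
  have q0: "q \<noteq> 0" using q(2) by (rule contrapos_nn) simp
  have qM: "of_nat q \<notin> M" using q(2) M_of_nat by auto
  obtain R where R: "R \<subseteq> carrier G" and sum:
    "\<And>f. class_function f \<Longrightarrow>
       (\<Sum>g\<in>carrier G. f g) = (\<Sum>x\<in>R. of_nat (card (conj_class G x)) * f x)"
    using class_representatives by blast
  define e where "e x = \<chi> (inv x) / of_nat q" for x
  have e_alt: "e x = idem_coeff G {\<chi>} x" for x
  proof -
    have "of_nat (Coset.order G) = \<chi> \<one> * of_nat q" using q(1) n by (simp add: field_simps)
    then show ?thesis using n by (simp add: e_def idem_coeff_def)
  qed
  have e_int: "loc_int (e x)" if "x \<in> carrier G" for x
    using that Irr_algebraic_int[OF \<chi>] qM unfolding e_def by (intro loc_intI) auto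
  have e_sum: "(\<Sum>x\<in>R. e x * central_char G \<psi> x) =
      (\<Sum>g\<in>carrier G. \<psi> g * \<chi> (inv g)) / (\<psi> \<one> * of_nat q)" if \<psi>: "\<psi> \<in> Irr G" for \<psi>
  proof -
    obtain m where m: "0 < m" "\<psi> \<one> = of_nat m" by (rule Irr_degree[OF \<psi>])
    have "(\<Sum>g\<in>carrier G. \<psi> g * \<chi> (inv g)) =
        (\<Sum>x\<in>R. of_nat (card (conj_class G x)) * (\<psi> x * \<chi> (inv x)))"
      by (rule sum) (simp add: class_function_def Irr_conj[OF \<chi>] Irr_conj[OF \<psi>] Irr_inv[OF \<chi>])
    also have "\<dots> = (\<psi> \<one> * of_nat q) * (\<Sum>x\<in>R. e x * central_char G \<psi> x)"
      unfolding sum_distrib_left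
    proof (rule sum.cong)
      fix x assume "x \<in> R"
      then have "of_nat (card (conj_class G x)) * \<psi> x = \<psi> \<one> * central_char G \<psi> x"
        using R central_char_class(1)[OF \<psi>] by blast
      then have "of_nat (card (conj_class G x)) * (\<psi> x * \<chi> (inv x)) =
          \<psi> \<one> * central_char G \<psi> x * \<chi> (inv x)"
        by (simp add: mult.assoc[symmetric])
      then show "of_nat (card (conj_class G x)) * (\<psi> x * \<chi> (inv x)) =
          \<psi> \<one> * of_nat q * (e x * central_char G \<psi> x)"
        using q0 by (simp add: e_def)
    qed simp
    finally show ?thesis using m q0 by simp
  qed
  have e_\<chi>: "(\<Sum>x\<in>R. e x * central_char G \<chi> x) = 1"
    using e_sum[OF \<chi>] Irr_norm[OF \<chi>] q n q0 by (simp add: field_simps)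
  \<comment> \<open>The idempotent acts as 1 on \<open>\<chi>\<close> and as 0 on \<open>\<psi>\<close>, so the reductions of \<open>\<omega>\<^sub>\<chi>\<close> and \<open>\<omega>\<^sub>\<psi>\<close> differ.\<close>
  have "B = {\<chi>}"
  proof -
    obtain \<theta> where \<theta>: "B = block_rel G M `` {\<theta>}" using B(1) by (auto simp: blocks_def elim: quotientE)
    have "\<psi> = \<chi>" if "\<psi> \<in> B" for \<psi>
    proof (rule ccontr)
      assume ne: "\<psi> \<noteq> \<chi>"
      have \<psi>: "\<psi> \<in> Irr G" and "\<And>x. x \<in> carrier G \<Longrightarrow> red M (central_char G \<chi> x) = red M (central_char G \<psi> x)"
        using \<theta> that B(2) by (auto simp: block_rel_def)
      then have diff: "central_char G \<chi> x - central_char G \<psi> x \<in> loc_ideal M" if "x \<in> carrier G" for x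
        using that by (simp add: red_eq_iff)
      have "(\<Sum>x\<in>R. e x * central_char G \<psi> x) = 0"
        using e_sum[OF \<psi>] Irr_orthogonal[OF \<psi> \<chi> ne] by simp
      then have "1 = (\<Sum>x\<in>R. e x * (central_char G \<chi> x - central_char G \<psi> x))"
        using e_\<chi> by (simp add: right_diff_distrib sum_subtractf)
      also have "\<dots> \<in> loc_ideal M"
        using R diff e_int by (intro loc_ideal_sum loc_ideal_mult(1)) auto
      finally show False using loc_ideal_1 by simp
    qed
    then show ?thesis using B(2) by blast
  qed
  have "\<exists>x\<in>R. e x * central_char G \<chi> x \<notin> loc_ideal M"
    using loc_ideal_sum[of R "\<lambda>x. e x * central_char G \<chi> x"] e_\<chi> loc_ideal_1 by auto
  then obtain x where x: "x \<in> carrier G" "e x * central_char G \<chi> x \<notin> loc_ideal M"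
    using R by blast
  have ex: "e x \<notin> loc_ideal M"
    using x loc_ideal_mult(2)[OF algebraic_loc_int[OF central_char_algebraic_int[OF \<chi> x(1)]]] by blast
  have "central_char G \<chi> x \<notin> loc_ideal M"
    using x loc_ideal_mult(1)[OF e_int] by blast
  then have "in_defect_class G M B x"
    using x ex \<open>B = {\<chi>}\<close> by (simp add: in_defect_class_def red_eq_zero_iff e_alt)
  \<comment> \<open>Otherwise \<open>e x = \<bar>C(x)\<bar> \<omega>\<^sub>\<chi>(x\<inverse>) / q\<^sup>2\<close> would lie in the maximal ideal of the localization.\<close>
  moreover have "odd (card (centralizer G x))"
  proof
    assume "even (card (centralizer G x))"
    then have c: "of_nat (card (centralizer G x)) \<in> M" by (simp add: M_of_nat)
    have ix: "inv x \<in> carrier G" using x by simp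
    have "of_nat (card (centralizer G x)) * central_char G \<chi> (inv x) = of_nat q * \<chi> (inv x)"
      using central_char_class(2)[OF \<chi> ix] unfolding centralizer_inv[OF x(1)] q(1) .
    then have "e x = (central_char G \<chi> (inv x) * of_nat (card (centralizer G x))) / (of_nat q * of_nat q)"
      using q0 by (simp add: e_def field_simps)
    also have "\<dots> \<in> loc_ideal M"
      using M_mult[OF c central_char_algebraic_int[OF \<chi> ix]] not_M_mult[OF _ _ qM qM]
      by (intro loc_idealI) (auto simp: algebraic_int_add_mult)
    finally show False using ex by simp
  qed
  then have "sylow_subgroup 2 (centralizer G x) G {\<one>}"
    using x(1) triv_subgroup by (auto simp: sylow_subgroup_def centralizer_def not_dvd_imp_multiplicity_0)
  ultimately have "defect_group 2 G M B {\<one>}" unfolding defect_group_def by blast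
  then show ?thesis unfolding positive_defect_def by blast
qed

theorem positive_defect_nonvanishing:
  assumes \<chi>: "\<chi> \<in> Irr G" and B: "B \<in> blocks G M" "\<chi> \<in> B" "positive_defect 2 G M B"
  obtains t where "involution G t" "\<chi> t \<noteq> 0"
proof -
  obtain q where "of_nat (Coset.order G) / \<chi> \<one> = of_nat q" by (rule degree_dvd_order[OF \<chi>])
  then have "\<not> (\<forall>t. involution G t \<longrightarrow> \<chi> t = 0)"
    using vanishing_imp_defect_zero[OF \<chi>] defect_zero_block[OF \<chi> _ _ B(1,2)] B(3) by blast
  then show ?thesis using that by blast
qed

section \<open>Bessel's inequality\<close>


text \<open>Bessel's inequality for the indicator function \<open>u\<close> of the class of \<open>t\<close>: in the proof \<open>s\<close> is the
  orthogonal projection of \<open>u\<close> onto the span of the characters in \<open>A\<close>, and \<open>c \<chi>\<close> is the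
  coefficient of \<open>\<chi>\<close> in it.\<close>

theorem sum_norm_le_centralizer:
  assumes A: "finite A" "A \<subseteq> Irr G" and t: "t \<in> carrier G"
  shows "(\<Sum>\<chi>\<in>A. (cmod (\<chi> t))\<^sup>2) \<le> real (card (centralizer G t))"
proof -
  let ?K = "conj_class G t"
  define k where "k = card ?K"
  define N where "N = Coset.order G"
  define S where "S = (\<Sum>\<chi>\<in>A. (cmod (\<chi> t))\<^sup>2)"
  define c :: "('a \<Rightarrow> complex) \<Rightarrow> complex" where "c \<chi> = of_nat k / of_nat N * cnj (\<chi> t)" for \<chi>
  define u :: "'a \<Rightarrow> complex" where "u g = (if g \<in> ?K then 1 else 0)" for g
  define s :: "'a \<Rightarrow> complex" where "s g = (\<Sum>\<chi>\<in>A. c \<chi> * \<chi> g)" for g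
  have N: "N > 0" using order_pos by (simp add: N_def)
  have kN: "k * card (centralizer G t) = N"
    using card_conj_class_centralizer[OF t] by (simp add: k_def N_def)
  then have k: "k > 0" using N by (cases k) auto
  have Ksub: "?K \<subseteq> carrier G" by (rule conj_class_subset[OF t])
  have \<chi>K: "\<chi> g = \<chi> t" if "\<chi> \<in> A" "g \<in> ?K" for \<chi> g
    using that A t Irr_conj by (auto simp: conj_class_def)
  have S: "of_real S = (\<Sum>\<chi>\<in>A. \<chi> t * cnj (\<chi> t))"
    unfolding S_def of_real_sum complex_norm_square ..
  have uf: "(\<Sum>g\<in>carrier G. u g * f g) = (\<Sum>g\<in>?K. f g)" for f
    unfolding u_def using fin Ksub by (intro sum.mono_neutral_cong_right) auto
  have uu: "(\<Sum>g\<in>carrier G. u g * cnj (u g)) = of_nat k"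
    unfolding uf by (simp add: u_def k_def)
  have us: "(\<Sum>g\<in>carrier G. u g * cnj (s g)) = of_nat k * of_nat k / of_nat N * of_real S"
  proof -
    have "(\<Sum>g\<in>?K. cnj (s g)) = (\<Sum>g\<in>?K. cnj (s t))"
      by (intro sum.cong) (auto simp: s_def \<chi>K)
    moreover have "s t = of_nat k / of_nat N * of_real S"
      unfolding s_def c_def S sum_distrib_left by (intro sum.cong) (simp_all add: mult_ac)
    ultimately show ?thesis unfolding uf by (simp add: k_def)
  qed
  have su: "(\<Sum>g\<in>carrier G. s g * cnj (u g)) = of_nat k * of_nat k / of_nat N * of_real S"
  proof -
    have "(\<Sum>g\<in>carrier G. s g * cnj (u g)) = cnj (\<Sum>g\<in>carrier G. u g * cnj (s g))"
      by (simp add: mult.commute)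
    then show ?thesis unfolding us by simp
  qed
  have orth: "(\<Sum>g\<in>carrier G. \<chi> g * cnj (\<psi> g)) = (if \<chi> = \<psi> then of_nat N else 0)"
    if "\<chi> \<in> A" "\<psi> \<in> A" for \<chi> \<psi>
  proof -
    have "(\<Sum>g\<in>carrier G. \<chi> g * cnj (\<psi> g)) = (\<Sum>g\<in>carrier G. \<chi> g * \<psi> (inv g))"
      using that A by (intro sum.cong) (auto simp: Irr_inv)
    then show ?thesis using that A Irr_orthogonal Irr_norm unfolding N_def by (metis subsetD)
  qed
  have "(\<Sum>g\<in>carrier G. s g * cnj (s g)) =
      (\<Sum>g\<in>carrier G. \<Sum>\<chi>\<in>A. \<Sum>\<psi>\<in>A. c \<chi> * cnj (c \<psi>) * (\<chi> g * cnj (\<psi> g)))"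
    by (simp add: s_def sum_product mult_ac)
  also have "\<dots> = (\<Sum>\<chi>\<in>A. \<Sum>\<psi>\<in>A. \<Sum>g\<in>carrier G. c \<chi> * cnj (c \<psi>) * (\<chi> g * cnj (\<psi> g)))"
    by (subst sum.swap, intro sum.cong refl sum.swap)
  also have "\<dots> = (\<Sum>\<chi>\<in>A. \<Sum>\<psi>\<in>A. c \<chi> * cnj (c \<psi>) * (if \<chi> = \<psi> then of_nat N else 0))"
    by (intro sum.cong refl) (simp add: sum_distrib_left[symmetric] orth)
  also have "\<dots> = (\<Sum>\<chi>\<in>A. c \<chi> * cnj (c \<chi>) * of_nat N)"
    using A by (simp add: if_distrib[of "\<lambda>z. _ * z"] cong: if_cong)
  also have "\<dots> = of_nat k * of_nat k / of_nat N * of_real S"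
    using N by (simp add: c_def S sum_distrib_left field_simps)
  finally have ss: "(\<Sum>g\<in>carrier G. s g * cnj (s g)) = of_nat k * of_nat k / of_nat N * of_real S" .
  have "complex_of_real (\<Sum>g\<in>carrier G. (cmod (u g - s g))\<^sup>2) =
      (\<Sum>g\<in>carrier G. (u g - s g) * cnj (u g - s g))"
    unfolding of_real_sum complex_norm_square ..
  also have "\<dots> = of_nat k - of_nat k * of_nat k / of_nat N * of_real S"
    using uu us su ss by (simp add: algebra_simps sum.distrib sum_subtractf)
  also have "\<dots> = complex_of_real (real k - real k * real k / real N * S)" by simp
  finally have "real k - real k * real k / real N * S = (\<Sum>g\<in>carrier G. (cmod (u g - s g))\<^sup>2)"
    by (simp only: of_real_eq_iff)
  also have "\<dots> \<ge> 0" by (intro sum_nonneg) simp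
  finally have "real k * real k / real N * S \<le> real k" by simp
  then have "real k * S \<le> real N" using k N by (simp add: field_simps)
  then have "real k * S \<le> real k * real (card (centralizer G t))"
    unfolding kN[symmetric] by simp
  then show ?thesis using k by (simp add: S_def)
qed

end

section \<open>Elementary abelian 2-subgroups\<close>

text \<open>The right-hand side is the sum of \<open>(a \<xi> - a \<mu>)\<^sup>2\<close> over the unordered pairs.  The indices where
  \<open>a\<close> has the value \<open>a x\<close> and the others give \<open>\<bar>S\<bar> \<bar>T\<bar> \<ge> \<bar>S\<bar> + \<bar>T\<bar> - 1\<close> pairs with a term of at
  least 1.\<close>

lemma nonconstant_variance:
  fixes a :: "'b \<Rightarrow> int"
  assumes D: "finite D" and "x \<in> D" "y \<in> D" "a x \<noteq> a y"
  shows "int (card D) - 1 \<le> int (card D) * (\<Sum>\<xi>\<in>D. (a \<xi>)\<^sup>2) - (\<Sum>\<xi>\<in>D. a \<xi>)\<^sup>2"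
proof -
  define S where "S = {z \<in> D. a z = a x}"
  define T where "T = {z \<in> D. a z \<noteq> a x}"
  have fin: "finite S" "finite T" and D_un: "D = S \<union> T" and disj: "S \<inter> T = {}"
    using D by (auto simp: S_def T_def)
  have "x \<in> S" "y \<in> T" using assms by (auto simp: S_def T_def)
  then have "card S > 0" "card T > 0" using fin card_gt_0_iff by blast+
  then have pos: "int (card S) \<ge> 1" "int (card T) \<ge> 1" by linarith+
  have row: "(if z \<in> S then int (card T) else int (card S)) \<le> (\<Sum>w\<in>D. (a z - a w)\<^sup>2)" if "z \<in> D" for z
  proof -
    define U where "U = (if z \<in> S then T else S)"
    have U: "U \<subseteq> D" "\<And>w. w \<in> U \<Longrightarrow> a z \<noteq> a w"
      using that by (auto simp: U_def S_def T_def split: if_splits)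
    have "1 \<le> (a z - a w)\<^sup>2" if "w \<in> U" for w
      using U(2)[OF that] zero_less_power2[of "a z - a w"] by linarith
    then have "(\<Sum>w\<in>U. 1) \<le> (\<Sum>w\<in>U. (a z - a w)\<^sup>2)" by (rule sum_mono)
    also have "\<dots> \<le> (\<Sum>w\<in>D. (a z - a w)\<^sup>2)" by (rule sum_mono2[OF D U(1)]) simp
    finally show ?thesis by (simp add: U_def split: if_splits)
  qed
  have "2 * int (card S) * int (card T) = (\<Sum>z\<in>D. if z \<in> S then int (card T) else int (card S))"
  proof -
    have "(\<Sum>z\<in>S. if z \<in> S then int (card T) else int (card S)) = int (card S) * int (card T)"
      by simp
    moreover have "(\<Sum>z\<in>T. if z \<in> S then int (card T) else int (card S)) = (\<Sum>z\<in>T. int (card S))"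
      using disj by (intro sum.cong) auto
    moreover have "(\<Sum>z\<in>D. if z \<in> S then int (card T) else int (card S)) =
        (\<Sum>z\<in>S. if z \<in> S then int (card T) else int (card S)) +
        (\<Sum>z\<in>T. if z \<in> S then int (card T) else int (card S))"
      unfolding D_un by (rule sum.union_disjoint[OF fin disj])
    ultimately show ?thesis by simp
  qed
  also have "\<dots> \<le> (\<Sum>z\<in>D. \<Sum>w\<in>D. (a z - a w)\<^sup>2)" by (rule sum_mono) (rule row)
  also have "\<dots> = 2 * (int (card D) * (\<Sum>\<xi>\<in>D. (a \<xi>)\<^sup>2) - (\<Sum>\<xi>\<in>D. a \<xi>)\<^sup>2)"
  proof -
    have "(\<Sum>z\<in>D. \<Sum>w\<in>D. (a z - a w)\<^sup>2) = (\<Sum>z\<in>D. \<Sum>w\<in>D. (a z)\<^sup>2 + (a w)\<^sup>2 - 2 * (a z * a w))"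
      by (intro sum.cong refl) (simp add: power2_diff)
    also have "\<dots> = 2 * (int (card D) * (\<Sum>\<xi>\<in>D. (a \<xi>)\<^sup>2)) - 2 * (\<Sum>z\<in>D. \<Sum>w\<in>D. a z * a w)"
      by (simp add: sum.distrib sum_subtractf sum_distrib_left[symmetric])
    also have "(\<Sum>z\<in>D. \<Sum>w\<in>D. a z * a w) = (\<Sum>\<xi>\<in>D. a \<xi>)\<^sup>2"
      by (simp add: power2_eq_square sum_product)
    finally show ?thesis by (simp add: right_diff_distrib)
  qed
  finally have "int (card S) * int (card T) \<le> int (card D) * (\<Sum>\<xi>\<in>D. (a \<xi>)\<^sup>2) - (\<Sum>\<xi>\<in>D. a \<xi>)\<^sup>2"
    by simp
  moreover have "int (card D) - 1 \<le> int (card S) * int (card T)"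
  proof -
    have "(int (card S) - 1) * (int (card T) - 1) \<ge> 0" using pos by (intro mult_nonneg_nonneg) auto
    moreover have "int (card D) = int (card S) + int (card T)"
      unfolding D_un using card_Un_disjoint[OF fin disj] by simp
    ultimately show ?thesis by (simp add: algebra_simps)
  qed
  ultimately show ?thesis by linarith
qed

text \<open>An elementary abelian 2-subgroup \<open>E\<close> of \<open>G\<close>; commutativity follows from \<open>x\<^sup>2 = \<one>\<close>.\<close>

locale elementary_abelian_2 = fin_group G for G (structure) +
  fixes E
  assumes sub: "subgroup E G" and square: "x \<in> E \<Longrightarrow> x \<otimes> x = \<one>"
begin

lemma E_carrier: "x \<in> E \<Longrightarrow> x \<in> carrier G"
  using subgroup.mem_carrier[OF sub] .

lemma E_mult: "x \<in> E \<Longrightarrow> y \<in> E \<Longrightarrow> x \<otimes> y \<in> E"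
  using subgroup.m_closed[OF sub] .

lemma E_one: "\<one> \<in> E"
  using subgroup.one_closed[OF sub] .

lemma finite_E: "finite E"
  using finite_subset[OF subgroup.subset[OF sub] fin] .

lemma card_E_pos: "0 < card E"
  using E_one finite_E by (auto simp: card_gt_0_iff)

lemma E_inv: "x \<in> E \<Longrightarrow> inv x = x"
  using square E_carrier by (simp add: inv_equality)

lemma E_comm:
  assumes "x \<in> E" "y \<in> E"
  shows "x \<otimes> y = y \<otimes> x"
proof -
  have "x \<otimes> y = inv (x \<otimes> y)" using E_inv[OF E_mult] assms by simp
  also have "\<dots> = y \<otimes> x" using assms E_carrier E_inv by (simp add: inv_mult_group)
  finally show ?thesis .
qed

lemma E_cancel: "x \<in> E \<Longrightarrow> y \<in> E \<Longrightarrow> x \<otimes> (x \<otimes> y) = y"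
  using square[of x] E_carrier by (simp add: m_assoc[symmetric])

lemma E_mult_eq_one: "x \<in> E \<Longrightarrow> y \<in> E \<Longrightarrow> x \<otimes> y = \<one> \<longleftrightarrow> x = y"
  using E_cancel[of x y] square[of x] E_carrier by (metis r_one)

lemma E_sum_translate:
  assumes "x \<in> E"
  shows "(\<Sum>y\<in>E. f (x \<otimes> y)) = (\<Sum>y\<in>E. f y)"
  by (rule sum.reindex_bij_witness[of _ "\<lambda>y. x \<otimes> y" "\<lambda>y. x \<otimes> y"])
    (use assms in \<open>auto simp: E_cancel E_mult\<close>)

text \<open>The linear characters of \<open>E\<close>.  They take the values \<open>1\<close> and \<open>-1\<close>, taken here as integers, and
  are made \<open>undefined\<close> outside \<open>E\<close>, so that the set is finite and has \<open>\<bar>E\<bar>\<close> elements.\<close>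

definition dual :: "('a \<Rightarrow> int) set" where
  "dual = {\<xi> \<in> E \<rightarrow>\<^sub>E {1, -1}. \<forall>x\<in>E. \<forall>y\<in>E. \<xi> (x \<otimes> y) = \<xi> x * \<xi> y}"

lemma finite_dual: "finite dual"
proof (rule finite_subset)
  show "dual \<subseteq> E \<rightarrow>\<^sub>E {1, -1}" by (auto simp: dual_def)
qed (simp add: finite_PiE finite_E)

lemma dual_mult: "\<xi> \<in> dual \<Longrightarrow> x \<in> E \<Longrightarrow> y \<in> E \<Longrightarrow> \<xi> (x \<otimes> y) = \<xi> x * \<xi> y"
  by (auto simp: dual_def)

lemma dual_value: "\<xi> \<in> dual \<Longrightarrow> x \<in> E \<Longrightarrow> \<xi> x = 1 \<or> \<xi> x = -1"
  by (auto simp: dual_def PiE_def Pi_def)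

lemma dual_square: "\<xi> \<in> dual \<Longrightarrow> x \<in> E \<Longrightarrow> \<xi> x * \<xi> x = 1"
  using dual_value by force

lemma dual_one: "\<xi> \<in> dual \<Longrightarrow> \<xi> \<one> = 1"
  using dual_mult[of \<xi> \<one> \<one>] dual_value[of \<xi> \<one>] E_one by auto

text \<open>The character takes the value 1 on a subgroup of \<open>E\<close> that is maximal among those without \<open>x\<close>,
  and \<open>-1\<close> elsewhere on \<open>E\<close>.\<close>

lemma dual_separates:
  assumes x: "x \<in> E" "x \<noteq> \<one>"
  obtains \<xi> where "\<xi> \<in> dual" "\<xi> x = -1"
proof -
  define Sub where "Sub = {H. H \<subseteq> E \<and> \<one> \<in> H \<and> x \<notin> H \<and> (\<forall>y\<in>H. \<forall>z\<in>H. y \<otimes> z \<in> H)}"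
  have "finite Sub" unfolding Sub_def using finite_E by simp
  moreover have "{\<one>} \<in> Sub" using x E_one by (auto simp: Sub_def)
  ultimately obtain H where H: "H \<in> Sub" and max: "\<And>K. K \<in> Sub \<Longrightarrow> H \<subseteq> K \<Longrightarrow> K = H"
    using finite_has_maximal[of Sub] by (metis empty_iff)
  have HE: "y \<in> E" if "y \<in> H" for y using that H by (auto simp: Sub_def)
  have Hm: "y \<otimes> z \<in> H" if "y \<in> H" "z \<in> H" for y z using that H by (auto simp: Sub_def)
  have xH: "x \<notin> H" and 1: "\<one> \<in> H" using H by (auto simp: Sub_def)
  \<comment> \<open>By maximality \<open>H\<close> has index 2 in \<open>E\<close>.\<close>
  have coset: "x \<otimes> y \<in> H" if y: "y \<in> E" "y \<notin> H" for y
  proof -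
    define K where "K = H \<union> (\<lambda>h. y \<otimes> h) ` H"
    have "K \<noteq> H" using y 1 E_carrier r_one unfolding K_def by (metis UnI2 imageI)
    moreover have "H \<subseteq> K" by (simp add: K_def)
    ultimately have "K \<notin> Sub" using max by blast
    moreover have "K \<subseteq> E" using HE y E_mult by (auto simp: K_def)
    moreover have "\<one> \<in> K" using 1 by (simp add: K_def)
    moreover have "u \<otimes> v \<in> K" if "u \<in> K" "v \<in> K" for u v
    proof -
      have a: "(y \<otimes> h) \<otimes> k = y \<otimes> (h \<otimes> k)" if "h \<in> H" "k \<in> H" for h k
        using that y HE E_carrier m_assoc by simp
      have b: "h \<otimes> (y \<otimes> k) = y \<otimes> (h \<otimes> k)" if "h \<in> H" "k \<in> H" for h k
        using that y HE E_carrier E_comm by (metis m_assoc)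
      have c: "(y \<otimes> h) \<otimes> (y \<otimes> k) = h \<otimes> k" if "h \<in> H" "k \<in> H" for h k
        using that y HE a b E_cancel E_mult by (metis Hm)
      show ?thesis
        using that Hm by (auto simp: K_def a b c)
    qed
    ultimately have "x \<in> K" unfolding Sub_def by blast
    then obtain h where h: "h \<in> H" "x = y \<otimes> h" using xH by (auto simp: K_def)
    have "x \<otimes> y = h" using h y HE E_comm E_cancel E_mult by metis
    then show ?thesis using h by simp
  qed
  define \<xi> where "\<xi> = (\<lambda>y\<in>E. if y \<in> H then 1 else - 1 :: int)"
  have move: "y \<otimes> z \<in> H \<longleftrightarrow> z \<in> H" if "y \<in> H" "z \<in> E" for y z
    using that Hm HE E_cancel by metis
  have "\<xi> (y \<otimes> z) = \<xi> y * \<xi> z" if yz: "y \<in> E" "z \<in> E" for y z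
  proof -
    have "y \<otimes> z \<in> H \<longleftrightarrow> (y \<in> H \<longleftrightarrow> z \<in> H)"
    proof (cases "y \<in> H")
      case True
      then show ?thesis using move yz by simp
    next
      case y: False
      show ?thesis
      proof (cases "z \<in> H")
        case True
        then show ?thesis using move[of z y] yz y E_comm[of y z] by simp
      next
        case False
        have "(x \<otimes> y) \<otimes> (x \<otimes> z) = y \<otimes> z"
          using yz x E_carrier E_comm[of x y] by (metis E_cancel E_mult m_assoc)
        then show ?thesis using Hm[OF coset coset] yz y False by metis
      qed
    qed
    then show ?thesis using yz E_mult by (auto simp: \<xi>_def)
  qed
  then have "\<xi> \<in> dual" by (auto simp: dual_def \<xi>_def)
  moreover have "\<xi> x = -1" using x xH by (simp add: \<xi>_def)
  ultimately show ?thesis by (rule that)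
qed

lemma dual_product:
  assumes "\<xi> \<in> dual" "\<mu> \<in> dual"
  shows "(\<lambda>y\<in>E. \<xi> y * \<mu> y) \<in> dual"
proof -
  have "\<xi> y * \<mu> y \<in> {1, -1}" if "y \<in> E" for y
    using dual_value[OF assms(1) that] dual_value[OF assms(2) that] by auto
  then have "(\<lambda>y\<in>E. \<xi> y * \<mu> y) \<in> E \<rightarrow>\<^sub>E {1, -1}" by (rule restrict_PiE_iff[THEN iffD2, rule_format])
  then show ?thesis
    unfolding dual_def by (simp add: E_mult dual_mult[OF assms(1)] dual_mult[OF assms(2)])
qed

lemma dual_column_sum:
  assumes x: "x \<in> E" "x \<noteq> \<one>"
  shows "(\<Sum>\<xi>\<in>dual. \<xi> x) = 0"
proof -
  obtain \<mu> where \<mu>: "\<mu> \<in> dual" "\<mu> x = -1" using dual_separates[OF x] by blast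
  have twice: "(\<lambda>y\<in>E. \<mu> y * (\<lambda>z\<in>E. \<mu> z * \<xi> z) y) = \<xi>" if "\<xi> \<in> dual" for \<xi>
  proof
    fix y
    show "(\<lambda>y\<in>E. \<mu> y * (\<lambda>z\<in>E. \<mu> z * \<xi> z) y) y = \<xi> y"
      using that dual_square[OF \<mu>(1)]
      by (cases "y \<in> E") (auto simp: mult.assoc[symmetric] dual_def PiE_def extensional_def)
  qed
  have "(\<Sum>\<xi>\<in>dual. \<xi> x) = (\<Sum>\<xi>\<in>dual. - \<xi> x)"
    by (rule sum.reindex_bij_witness[of _ "\<lambda>\<xi>. \<lambda>y\<in>E. \<mu> y * \<xi> y" "\<lambda>\<xi>. \<lambda>y\<in>E. \<mu> y * \<xi> y"])
      (use twice dual_product \<mu> x in auto)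
  then show ?thesis by (simp add: sum_negf)
qed

lemma card_dual: "card dual = card E"
proof -
  define triv :: "'a \<Rightarrow> int" where "triv = (\<lambda>y\<in>E. 1)"
  have triv: "triv \<in> dual" using E_mult by (auto simp: triv_def dual_def)
  have row: "(\<Sum>x\<in>E. \<xi> x) = (if \<xi> = triv then int (card E) else 0)" if \<xi>: "\<xi> \<in> dual" for \<xi>
  proof (cases "\<xi> = triv")
    case False
    have "\<exists>y\<in>E. \<xi> y \<noteq> 1"
    proof (rule ccontr)
      assume "\<not> ?thesis"
      then have "\<xi> = triv" using \<xi> by (intro ext) (auto simp: triv_def dual_def PiE_def extensional_def)
      then show False using False by simp
    qed
    then obtain y where y: "y \<in> E" "\<xi> y = -1" using dual_value[OF \<xi>] by blast
    have "(\<Sum>x\<in>E. \<xi> x) = (\<Sum>x\<in>E. \<xi> (y \<otimes> x))" by (rule E_sum_translate[OF y(1), symmetric])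
    also have "\<dots> = - (\<Sum>x\<in>E. \<xi> x)" using y dual_mult[OF \<xi>] by (simp add: sum_negf)
    finally show ?thesis using False by simp
  qed (simp add: triv_def)
  have "int (card dual) = (\<Sum>x\<in>E. if x = \<one> then int (card dual) else 0)"
    using finite_E E_one by simp
  also have "\<dots> = (\<Sum>x\<in>E. \<Sum>\<xi>\<in>dual. \<xi> x)"
    by (intro sum.cong) (auto simp: dual_column_sum dual_one)
  also have "\<dots> = (\<Sum>\<xi>\<in>dual. \<Sum>x\<in>E. \<xi> x)" by (rule sum.swap)
  also have "\<dots> = int (card E)" using finite_dual triv by (simp add: row)
  finally show ?thesis by simp
qed

lemma dual_orthogonal:
  assumes "x \<in> E" "y \<in> E"
  shows "(\<Sum>\<xi>\<in>dual. \<xi> x * \<xi> y) = (if x = y then int (card E) else 0)"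
proof -
  have "(\<Sum>\<xi>\<in>dual. \<xi> x * \<xi> y) = (\<Sum>\<xi>\<in>dual. \<xi> (x \<otimes> y))"
    using assms by (intro sum.cong) (auto simp: dual_mult)
  also have "\<dots> = (if x = y then int (card E) else 0)"
  proof (cases "x = y")
    case True
    then show ?thesis using assms by (simp add: square dual_one card_dual)
  next
    case False
    then show ?thesis using assms dual_column_sum[OF E_mult] E_mult_eq_one by simp
  qed
  finally show ?thesis .
qed

text \<open>The multiplicity of \<open>\<xi>\<close> in the restriction of \<open>\<chi>\<close> to \<open>E\<close> is the trace of the projection onto
  the \<open>\<xi>\<close>-isotypic part, an idempotent matrix.\<close>

lemma multiplicity_integral:
  assumes \<chi>: "\<chi> \<in> Irr G" and \<xi>: "\<xi> \<in> dual"
  shows "(\<Sum>e\<in>E. of_int (\<xi> e) * \<chi> e) / of_nat (card E) \<in> \<int>"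
proof -
  obtain n \<rho> where \<rho>: "irreducible_rep G n \<rho>"
    "\<And>g. g \<in> carrier G \<Longrightarrow> \<chi> g = (\<Sum>i<n. \<rho> g $$ (i, i))"
    using IrrE[OF \<chi>] by metis
  let ?N = "of_nat (card E) :: complex"
  let ?s = "\<lambda>i j. \<Sum>e\<in>E. of_int (\<xi> e) * \<rho> e $$ (i, j)"
  define P where "P = mat n n (\<lambda>(i, j). ?s i j / ?N)"
  have N: "?N \<noteq> 0" using card_E_pos by simp
  have prod: "(\<Sum>k<n. ?s i k * ?s k j) = ?N * ?s i j" if ij: "i < n" "j < n" for i j
  proof -
    have "(\<Sum>k<n. ?s i k * ?s k j) =
        (\<Sum>k<n. \<Sum>e\<in>E. \<Sum>f\<in>E. of_int (\<xi> e * \<xi> f) * (\<rho> e $$ (i, k) * \<rho> f $$ (k, j)))"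
      unfolding sum_product by (intro sum.cong refl) simp
    also have "\<dots> = (\<Sum>e\<in>E. \<Sum>f\<in>E. \<Sum>k<n. of_int (\<xi> e * \<xi> f) * (\<rho> e $$ (i, k) * \<rho> f $$ (k, j)))"
      by (subst sum.swap, intro sum.cong refl sum.swap)
    also have "\<dots> = (\<Sum>e\<in>E. \<Sum>f\<in>E. of_int (\<xi> (e \<otimes> f)) * \<rho> (e \<otimes> f) $$ (i, j))"
      using ij E_carrier dual_mult[OF \<xi>]
      by (intro sum.cong refl) (simp add: rep_mult_entry[OF \<rho>(1)] sum_distrib_left)
    also have "\<dots> = (\<Sum>e\<in>E. ?s i j)"
      by (intro sum.cong refl E_sum_translate[where f = "\<lambda>e. of_int (\<xi> e) * \<rho> e $$ (i, j)"])
    finally show ?thesis by simp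
  qed
  have "P * P = P"
  proof (rule eq_matI)
    fix i j assume "i < dim_row P" "j < dim_col P"
    then have ij: "i < n" "j < n" by (auto simp: P_def)
    have "(P * P) $$ (i, j) = (\<Sum>k<n. (?s i k / ?N) * (?s k j / ?N))"
      using ij by (simp add: P_def scalar_prod_def lessThan_atLeast0)
    also have "\<dots> = (\<Sum>k<n. ?s i k * ?s k j) / (?N * ?N)"
      unfolding times_divide_times_eq by (rule sum_divide_distrib[symmetric])
    also have "\<dots> = P $$ (i, j)" using ij N by (simp add: prod P_def)
    finally show "(P * P) $$ (i, j) = P $$ (i, j)" .
  qed (auto simp: P_def)
  then have "mat_trace P \<in> \<int>" by (intro mat_trace_idempotent[of P n]) (auto simp: P_def)
  also have "mat_trace P = (\<Sum>i<n. ?s i i) / ?N"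
    by (simp add: mat_trace_def P_def sum_divide_distrib)
  also have "(\<Sum>i<n. ?s i i) = (\<Sum>e\<in>E. of_int (\<xi> e) * \<chi> e)"
    using E_carrier by (subst sum.swap) (simp add: \<rho>(2) sum_distrib_left)
  finally show ?thesis .
qed

theorem sum_norm_ge_card:
  assumes \<chi>: "\<chi> \<in> Irr G" and e0: "e0 \<in> E" "e0 \<noteq> \<one>" "\<chi> e0 \<noteq> 0"
  shows "real (card E) - 1 \<le> (\<Sum>e\<in>E - {\<one>}. (cmod (\<chi> e))\<^sup>2)"
proof -
  have "\<forall>\<xi>\<in>dual. \<exists>k. (\<Sum>e\<in>E. of_int (\<xi> e) * \<chi> e) / of_nat (card E) = of_int k"
    using multiplicity_integral[OF \<chi>] by (meson Ints_cases)
  then obtain a where a: "\<And>\<xi>. \<xi> \<in> dual \<Longrightarrow> (\<Sum>e\<in>E. of_int (\<xi> e) * \<chi> e) / of_nat (card E) = of_int (a \<xi>)"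
    by metis
  define F where "F e = (\<Sum>\<xi>\<in>dual. a \<xi> * \<xi> e)" for e
  have a': "(\<Sum>e\<in>E. of_int (\<xi> e) * \<chi> e) = of_nat (card E) * of_int (a \<xi>)" if "\<xi> \<in> dual" for \<xi>
    using a[OF that] card_E_pos by (simp add: field_simps)
  have \<chi>F: "\<chi> e = of_int (F e)" if e: "e \<in> E" for e
  proof -
    have "of_nat (card E) * of_int (F e) = (\<Sum>\<xi>\<in>dual. of_int (\<xi> e) * (\<Sum>f\<in>E. of_int (\<xi> f) * \<chi> f))"
      unfolding F_def of_int_sum of_int_mult sum_distrib_left[of "of_nat (card E)"]
      by (intro sum.cong refl) (simp only: a', simp only: mult_ac)
    also have "\<dots> = (\<Sum>f\<in>E. of_int (\<Sum>\<xi>\<in>dual. \<xi> e * \<xi> f) * \<chi> f)"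
      by (simp add: sum_distrib_left sum_distrib_right mult.assoc) (rule sum.swap)
    also have "\<dots> = (\<Sum>f\<in>E. if e = f then of_nat (card E) * \<chi> f else 0)"
      using e by (intro sum.cong) (auto simp: dual_orthogonal)
    also have "\<dots> = of_nat (card E) * \<chi> e" using e finite_E by simp
    finally show ?thesis using card_E_pos by simp
  qed
  have mult: "(\<Sum>e\<in>E. F e * \<xi> e) = int (card E) * a \<xi>" if "\<xi> \<in> dual" for \<xi>
  proof -
    have "complex_of_int (\<Sum>e\<in>E. F e * \<xi> e) = (\<Sum>e\<in>E. of_int (\<xi> e) * \<chi> e)"
      by (simp add: \<chi>F mult.commute)
    also have "\<dots> = complex_of_int (int (card E) * a \<xi>)" using a'[OF that] by simp
    finally show ?thesis by (simp only: of_int_eq_iff)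
  qed
  have "(\<Sum>e\<in>E. (F e)\<^sup>2) = (\<Sum>e\<in>E. \<Sum>\<xi>\<in>dual. a \<xi> * (F e * \<xi> e))"
  proof (rule sum.cong)
    fix e
    have "(F e)\<^sup>2 = F e * (\<Sum>\<xi>\<in>dual. a \<xi> * \<xi> e)" by (simp add: power2_eq_square F_def)
    then show "(F e)\<^sup>2 = (\<Sum>\<xi>\<in>dual. a \<xi> * (F e * \<xi> e))" by (simp add: sum_distrib_left mult_ac)
  qed simp
  also have "\<dots> = (\<Sum>\<xi>\<in>dual. a \<xi> * (\<Sum>e\<in>E. F e * \<xi> e))"
    by (subst sum.swap) (simp add: sum_distrib_left)
  also have "\<dots> = int (card E) * (\<Sum>\<xi>\<in>dual. (a \<xi>)\<^sup>2)"
    unfolding sum_distrib_left[of "int (card E)"]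
    by (intro sum.cong refl) (simp only: mult, simp only: power2_eq_square mult_ac)
  finally have parseval: "(\<Sum>e\<in>E. (F e)\<^sup>2) = int (card E) * (\<Sum>\<xi>\<in>dual. (a \<xi>)\<^sup>2)" .
  have F1: "F \<one> = (\<Sum>\<xi>\<in>dual. a \<xi>)" by (simp add: F_def dual_one)
  \<comment> \<open>If the multiplicities were all equal, \<open>\<chi>\<close> would vanish on \<open>E - {\<one>}\<close>.\<close>
  have "\<exists>\<xi>\<in>dual. \<exists>\<mu>\<in>dual. a \<xi> \<noteq> a \<mu>"
  proof (rule ccontr)
    assume "\<not> ?thesis"
    then obtain b where "\<And>\<xi>. \<xi> \<in> dual \<Longrightarrow> a \<xi> = b" by metis
    then have "F e0 = b * (\<Sum>\<xi>\<in>dual. \<xi> e0)" by (simp add: F_def sum_distrib_left)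
    then show False using dual_column_sum[OF e0(1,2)] \<chi>F[OF e0(1)] e0(3) by simp
  qed
  then have "int (card E) - 1 \<le> int (card E) * (\<Sum>\<xi>\<in>dual. (a \<xi>)\<^sup>2) - (\<Sum>\<xi>\<in>dual. a \<xi>)\<^sup>2"
    using nonconstant_variance[OF finite_dual] card_dual by metis
  also have "\<dots> = (\<Sum>e\<in>E - {\<one>}. (F e)\<^sup>2)"
    using parseval F1 finite_E E_one by (simp add: sum_diff1)
  finally have "real_of_int (int (card E) - 1) \<le> real_of_int (\<Sum>e\<in>E - {\<one>}. (F e)\<^sup>2)"
    by (simp only: of_int_le_iff)
  also have "\<dots> = (\<Sum>e\<in>E - {\<one>}. (cmod (\<chi> e))\<^sup>2)"
    by (simp add: \<chi>F)
  finally show ?thesis by simp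
qed

end

section \<open>Groups with a broad subgroup\<close>

lemma (in fin_group) involution_exists:
  assumes "even (Coset.order G)"
  obtains t where "involution G t"
proof -
  have "even (card {x \<in> carrier G. inv x = x})"
    using even_card_involution[of "carrier G" "\<lambda>x. inv x"] fin assms by (simp add: Coset.order_def)
  moreover have "\<one> \<in> {x \<in> carrier G. inv x = x}" by simp
  ultimately have "{x \<in> carrier G. inv x = x} \<noteq> {\<one>}" by force
  then obtain t where "t \<in> carrier G" "inv t = t" "t \<noteq> \<one>" by force
  then have "involution G t" using r_inv[of t] by (simp add: involution_iff)
  then show ?thesis by (rule that)
qed

theorem mainTheorem4:
  fixes G :: "('a, 'b) monoid_scheme" and M :: "complex set"
  assumes "group G" and "finite (carrier G)" and "even (Coset.order G)"
    and "\<exists>E. broad_subgroup E G"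
    and "maxideal_over 2 M"
  shows "\<exists>t. involution G t \<and>
           card {\<chi> \<in> Irr G. \<exists>B\<in>blocks G M. \<chi> \<in> B \<and> positive_defect 2 G M B}
             \<le> card (centralizer G t)"
proof -
  interpret fin_group_mod_2 G M
    using assms by (simp add: fin_group_mod_2_def fin_group_def fin_group_axioms_def maxideal_over_2_def)
  obtain E where broad: "broad_subgroup E G" using assms(4) by blast
  then have sub: "subgroup E G" and exp: "\<And>x. x \<in> E \<Longrightarrow> x [^]\<^bsub>G\<^esub> (2::nat) = \<one>\<^bsub>G\<^esub>"
    by (auto simp: broad_subgroup_def elementary_abelian_def)
  have "x \<otimes>\<^bsub>G\<^esub> x = \<one>\<^bsub>G\<^esub>" if "x \<in> E" for x
    using exp[OF that] subgroup.mem_carrier[OF sub that] by (simp add: numeral_2_eq_2)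
  then interpret elementary_abelian_2 G E
    using sub by (simp add: elementary_abelian_2_def elementary_abelian_2_axioms_def fin_group_axioms)
  have meets: "\<exists>e\<in>E - {\<one>\<^bsub>G\<^esub>}. e \<in> conj_class G t" if t: "involution G t" for t
  proof -
    have tc: "t \<in> carrier G" "t \<noteq> \<one>\<^bsub>G\<^esub>" using t by (auto simp: involution_iff)
    obtain e where e: "e \<in> E" "e \<in> conj_class G t" using broad t by (auto simp: broad_subgroup_def)
    have "e \<noteq> \<one>\<^bsub>G\<^esub>"
    proof
      assume "e = \<one>\<^bsub>G\<^esub>"
      then have "t \<in> conj_class G \<one>\<^bsub>G\<^esub>" using e tc conj_class_eq conj_class_self by metis
      then show False using tc by (auto simp: conj_class_def)
    qed
    then show ?thesis using e by blast
  qed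
  have invol: "involution G e" if "e \<in> E - {\<one>\<^bsub>G\<^esub>}" for e
    using that E_carrier square by (auto simp: involution_iff)
  obtain t0 where t0: "involution G t0" by (rule involution_exists[OF assms(3)])
  define A where "A = {\<chi> \<in> Irr G. \<exists>B\<in>blocks G M. \<chi> \<in> B \<and> positive_defect 2 G M B}"
  show ?thesis
  proof (cases "finite A")
    case False
    \<comment> \<open>The finiteness of \<open>Irr G\<close> is not needed: an infinite set has \<open>card\<close> equal to 0.\<close>
    then show ?thesis using t0 by (auto simp: A_def)
  next
    case True
    let ?E = "E - {\<one>\<^bsub>G\<^esub>}"
    have card_E: "real (card ?E) = real (card E) - 1"
      using card_E_pos E_one by simp
    have ne: "?E \<noteq> {}" using meets[OF t0] by blast
    have lower: "real (card ?E) \<le> (\<Sum>e\<in>?E. (cmod (\<chi> e))\<^sup>2)" if "\<chi> \<in> A" for \<chi>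
    proof -
      from \<open>\<chi> \<in> A\<close> obtain B
        where \<chi>: "\<chi> \<in> Irr G" "B \<in> blocks G M" "\<chi> \<in> B" "positive_defect 2 G M B"
        unfolding A_def by blast
      obtain t where t: "involution G t" "\<chi> t \<noteq> 0"
        by (rule positive_defect_nonvanishing[OF \<chi>])
      obtain e where e: "e \<in> ?E" "e \<in> conj_class G t" using meets[OF t(1)] by blast
      have "\<chi> e = \<chi> t" using e t Irr_conj[OF \<chi>(1)] by (auto simp: conj_class_def involution_iff)
      then show ?thesis using sum_norm_ge_card[OF \<chi>(1), of e] e t card_E by simp
    qed
    have "\<exists>e\<in>?E. card A \<le> card (centralizer G e)"
    proof (rule ccontr)
      assume "\<not> ?thesis"
      then have less: "real (card (centralizer G e)) < real (card A)" if "e \<in> ?E" for e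
        using that by (simp add: not_le)
      have "real (card A) * real (card ?E) = (\<Sum>\<chi>\<in>A. real (card ?E))" by simp
      also have "\<dots> \<le> (\<Sum>\<chi>\<in>A. \<Sum>e\<in>?E. (cmod (\<chi> e))\<^sup>2)" by (rule sum_mono) (rule lower)
      also have "\<dots> = (\<Sum>e\<in>?E. \<Sum>\<chi>\<in>A. (cmod (\<chi> e))\<^sup>2)" by (rule sum.swap)
      also have "\<dots> \<le> (\<Sum>e\<in>?E. real (card (centralizer G e)))"
        using E_carrier by (intro sum_mono sum_norm_le_centralizer[OF True]) (auto simp: A_def)
      also have "\<dots> < (\<Sum>e\<in>?E. real (card A))"
        using ne finite_E less by (intro sum_strict_mono) auto
      also have "\<dots> = real (card A) * real (card ?E)" by simp
      finally show False by simp
    qed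
    then show ?thesis using invol unfolding A_def by blast
  qed
qed

end
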